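(* Let $G$ be a second-countable unimodular amenable locally compact group with Haar measure $\mu_G$, and let $(\pi,\mathcal{H}_\pi)$ be a discrete series (i.e. irreducible square-integrable) projective unitary representation of $G$ of formal degree $d_\pi>0$. Let $\Lambda\subseteq G$ be discrete. Suppose that $\pi(\Lambda)g = (\pi(\lambda)g)_{\lambda\in\Lambda}$ is a frame for $\mathcal{H}_\pi$ with $g\in\mathcal{B}^2_\pi$. If there exists a subset $\Gamma\subseteq\Lambda$ with $D^-(\Gamma)>0$ such that $(\pi(\lambda)g)_{\lambda\in\Lambda\setminus\Gamma}$ is a frame for $\mathcal{H}_\pi$, then $D^+(\Lambda)>d_\pi$.
   Context: Fix a compact symmetric neighborhood $Q \subseteq G$ of the identity. Projective representations: A projective unitary representation $(\pi,\mathcal{H}_\pi)$ of $G$ on a Hilbert space $\mathcal{H}_\pi$ is a strongly measurable map $\pi : G \to \mathcal{U}(\mathcal{H}_\pi)$ with $\pi(xy) = \sigma(x,y)\pi(x)\pi(y)$ for all $x,y\in G$, for some function $\sigma : G\times G \to \mathbb{T}$. It is irreducible if $\{0\}$ and $\mathcal{H}_\pi$ are the only closed subspaces invariant under all $\pi(x)$, $x\in G$. For $f,g\in\mathcal{H}_\pi$ put $V_g f(x) = \langle f,\pi(x)g\rangle$, $x \in G$. The irreducible representation $\pi$ is square-integrable (a discrete series representation) if $\int_G |V_g g|^2\,d\mu_G<\infty$ for some $g\neq 0$. Its formal degree is the number $d_\pi>0$ such that $\int_G \langle f_1,\pi(x)g_1\rangle\langle\pi(x)g_2,f_2\rangle\,d\mu_G(x)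 = d_\pi^{-1}\langle f_1,f_2\rangle\overline{\langle g_1,g_2\rangle}$ for all $f_1,f_2,g_1,g_2\in\mathcal{H}_\pi$. Localized vectors: For $F \in L^\infty_{\mathrm{loc}}(G)$ let $M^L F(x) = \operatorname{ess\,sup}_{z\in Q}|F(xz)|$, and $W^L(L^2) = \{F\in L^\infty_{\mathrm{loc}}(G) : M^LF\in L^2(G)\}$. Then $\mathcal{B}^2_\pi = \{g\in\mathcal{H}_\pi : V_g g\in W^L(L^2)\}$. Frames: A family $(g_i)_{i\in I}$ in $\mathcal{H}_\pi$ is a frame for $\mathcal{H}_\pi$ if there are constants $0<A\le B<\infty$ with $A\|f\|^2\le\sum_{i\in I}|\langle f,g_i\rangle|^2\le B\|f\|^2$ for all $f\in\mathcal{H}_\pi$. Beurling density: A (right) strong Følner sequence is a sequence $(K_n)_{n\in\mathbb{N}}$ of compact sets $K_n \subseteq G$ of positive measure such that, for every compact $K\subseteq G$, $\mu_G(K_nK\,\Delta\,K_n)/\mu_G(K_n)\to 0$ and $\mu_G(K_nK\cap K_n^cK)/\mu_G(K_n)\to0$ as $n\to\infty$. Such sequences exist since $G$ is amenable. The lower and upper Beurling densities of a discrete set $\Lambda\subseteq G$ are $D^-(\Lambda) = \lim_{n\to\infty}\inf_{x\in G}\frac{\#(\Lambda\cap xK_n)}{\mu_G(K_n)}$ and $D^+(\Lambda) = \lim_{n\to\infty}\sup_{x\in G}\frac{\#(\Lambda\cap xK_n)}{\mu_G(K_n)}$, where $(K_n)_{n \in \mathbb{N}}$ is any strong Følner sequence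 (the values do not depend on this choice). *)

theory Defs
  imports
    "HOL-Analysis.Analysis"
    "HOL-Library.Set_Algebras"
    "HOL-Probability.Essential_Supremum"
begin

text \<open>
  Groups are written additively because the library's class of (not necessarily commutative)
  topological groups is \<open>topological_group_add\<close>: the product \<open>x y\<close> is \<open>x + y\<close>, the inverse is \<open>- x\<close>
  and the identity is \<open>0\<close>. For sets, \<open>A + B\<close> is the product set.
\<close>

section \<open>Complex Hilbert spaces\<close>

text \<open>The inner product is linear in its first argument.\<close>

class complex_hilbert_space = banach +
  fixes scaleC :: "complex \<Rightarrow> 'a \<Rightarrow> 'a" (infixr \<open>*\<^sub>C\<close> 75)
    and cinner :: "'a \<Rightarrow> 'a \<Rightarrow> complex"
  assumes scaleC_add_right: "c *\<^sub>C (x + y) = c *\<^sub>C x + c *\<^sub>C y"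
    and scaleC_add_left: "(b + c) *\<^sub>C x = b *\<^sub>C x + c *\<^sub>C x"
    and scaleC_scaleC: "b *\<^sub>C (c *\<^sub>C x) = (b * c) *\<^sub>C x"
    and scaleC_of_real: "complex_of_real r *\<^sub>C x = r *\<^sub>R x"
    and cinner_commute: "cinner x y = cnj (cinner y x)"
    and cinner_add_left: "cinner (x + y) z = cinner x z + cinner y z"
    and cinner_scaleC_left: "cinner (c *\<^sub>C x) y = c * cinner x y"
    and cinner_self: "cinner x x = complex_of_real ((norm x)\<^sup>2)"

definition unitary :: "('h::complex_hilbert_space \<Rightarrow> 'h) \<Rightarrow> bool" where
  "unitary U \<longleftrightarrow>
     (\<forall>f g. U (f + g) = U f + U g) \<and> (\<forall>c f. U (c *\<^sub>C f) = c *\<^sub>C U f) \<and>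
     surj U \<and> (\<forall>f g. cinner (U f) (U g) = cinner f g)"

definition closed_csubspace :: "'h::complex_hilbert_space set \<Rightarrow> bool" where
  "closed_csubspace V \<longleftrightarrow>
     closed V \<and> 0 \<in> V \<and> (\<forall>f\<in>V. \<forall>g\<in>V. f + g \<in> V) \<and> (\<forall>c. \<forall>f\<in>V. c *\<^sub>C f \<in> V)"

definition is_frame :: "'i set \<Rightarrow> ('i \<Rightarrow> 'h::complex_hilbert_space) \<Rightarrow> bool" where
  "is_frame I v \<longleftrightarrow>
     (\<exists>A B::real. 0 < A \<and> A \<le> B \<and>
       (\<forall>f. ennreal (A * (norm f)\<^sup>2) \<le> (\<Sum>\<^sub>\<infinity>i\<in>I. ennreal ((cmod (cinner f (v i)))\<^sup>2)) \<and>
            (\<Sum>\<^sub>\<infinity>i\<in>I. ennreal ((cmod (cinner f (v i)))\<^sup>2)) \<le> ennreal (B * (norm f)\<^sup>2)))"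

section \<open>Haar measure, unimodularity, amenability\<close>

text \<open>A nonzero left-invariant Radon measure on the Borel sets.\<close>

definition haar_measure :: "'g::{topological_group_add, t2_space} measure \<Rightarrow> bool" where
  "haar_measure \<mu> \<longleftrightarrow>
     sets \<mu> = sets borel \<and>
     emeasure \<mu> UNIV \<noteq> 0 \<and>
     (\<forall>K. compact K \<longrightarrow> emeasure \<mu> K < \<infinity>) \<and>
     (\<forall>A\<in>sets borel. emeasure \<mu> A = (INF U\<in>{U. open U \<and> A \<subseteq> U}. emeasure \<mu> U)) \<and>
     (\<forall>U. open U \<longrightarrow> emeasure \<mu> U = (SUP K\<in>{K. compact K \<and> K \<subseteq> U}. emeasure \<mu> K)) \<and>
     (\<forall>x. \<forall>A\<in>sets borel. emeasure \<mu> ((\<lambda>a. x + a) ` A) = emeasure \<mu> A)"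

text \<open>For a Haar measure \<open>\<mu>\<close>, this says that the modular function is trivial.\<close>

definition unimodular :: "'g::topological_group_add measure \<Rightarrow> bool" where
  "unimodular \<mu> \<longleftrightarrow> (\<forall>x. \<forall>A\<in>sets borel. emeasure \<mu> ((\<lambda>a. a + x) ` A) = emeasure \<mu> A)"

definition ess_bounded :: "'g::topological_group_add measure \<Rightarrow> ('g \<Rightarrow> real) set" where
  "ess_bounded \<mu> = {f \<in> borel_measurable \<mu>. \<exists>C. AE x in \<mu>. \<bar>f x\<bar> \<le> C}"

text \<open>
  There is a left-invariant mean on real \<open>L\<^sup>\<infinity>\<close>. The mean \<open>m\<close> takes representatives; linearity and
  positivity force it to agree on functions that coincide almost everywhere.
\<close>

definition amenable :: "'g::topological_group_add measure \<Rightarrow> bool" where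
  "amenable \<mu> \<longleftrightarrow>
     (\<exists>m :: ('g \<Rightarrow> real) \<Rightarrow> real.
       (\<forall>f\<in>ess_bounded \<mu>. \<forall>g\<in>ess_bounded \<mu>. m (\<lambda>x. f x + g x) = m f + m g) \<and>
       (\<forall>c. \<forall>f\<in>ess_bounded \<mu>. m (\<lambda>x. c * f x) = c * m f) \<and>
       (\<forall>f\<in>ess_bounded \<mu>. (AE x in \<mu>. 0 \<le> f x) \<longrightarrow> 0 \<le> m f) \<and>
       m (\<lambda>x. 1) = 1 \<and>
       (\<forall>y. \<forall>f\<in>ess_bounded \<mu>. m (\<lambda>x. f (- y + x)) = m f))"

section \<open>Projective unitary representations\<close>

definition projective_unitary_rep ::
    "('g::topological_group_add \<Rightarrow> 'h \<Rightarrow> 'h::complex_hilbert_space) \<Rightarrow> bool" where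
  "projective_unitary_rep \<pi> \<longleftrightarrow>
     (\<forall>x. unitary (\<pi> x)) \<and>
     (\<forall>f. (\<lambda>x. \<pi> x f) \<in> borel_measurable borel) \<and>
     (\<exists>\<sigma> :: 'g \<Rightarrow> 'g \<Rightarrow> complex.
        (\<forall>x y. cmod (\<sigma> x y) = 1) \<and> (\<forall>x y f. \<pi> (x + y) f = \<sigma> x y *\<^sub>C \<pi> x (\<pi> y f)))"

definition irreducible_rep :: "('g \<Rightarrow> 'h \<Rightarrow> 'h::complex_hilbert_space) \<Rightarrow> bool" where
  "irreducible_rep \<pi> \<longleftrightarrow>
     (\<forall>V. closed_csubspace V \<and> (\<forall>x. \<pi> x ` V \<subseteq> V) \<longrightarrow> V = {0} \<or> V = UNIV)"

definition matrix_coeff :: "('g \<Rightarrow> 'h \<Rightarrow> 'h::complex_hilbert_space) \<Rightarrow> 'h \<Rightarrow> 'h \<Rightarrow> 'g \<Rightarrow> complex"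
  where "matrix_coeff \<pi> g f x = cinner f (\<pi> x g)"

definition square_integrable_rep ::
    "'g measure \<Rightarrow> ('g \<Rightarrow> 'h \<Rightarrow> 'h::complex_hilbert_space) \<Rightarrow> bool" where
  "square_integrable_rep \<mu> \<pi> \<longleftrightarrow>
     (\<exists>g. g \<noteq> 0 \<and> (\<integral>\<^sup>+x. ennreal ((cmod (matrix_coeff \<pi> g g x))\<^sup>2) \<partial>\<mu>) < \<infinity>)"

definition discrete_series ::
    "'g::topological_group_add measure \<Rightarrow> ('g \<Rightarrow> 'h \<Rightarrow> 'h::complex_hilbert_space) \<Rightarrow> bool" where
  "discrete_series \<mu> \<pi> \<longleftrightarrow>
     projective_unitary_rep \<pi> \<and> irreducible_rep \<pi> \<and> square_integrable_rep \<mu> \<pi>"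

definition formal_degree ::
    "'g measure \<Rightarrow> ('g \<Rightarrow> 'h \<Rightarrow> 'h::complex_hilbert_space) \<Rightarrow> real \<Rightarrow> bool" where
  "formal_degree \<mu> \<pi> d \<longleftrightarrow>
     d > 0 \<and>
     (\<forall>f\<^sub>1 f\<^sub>2 g\<^sub>1 g\<^sub>2.
        has_bochner_integral \<mu> (\<lambda>x. cinner f\<^sub>1 (\<pi> x g\<^sub>1) * cinner (\<pi> x g\<^sub>2) f\<^sub>2)
          (inverse (complex_of_real d) * cinner f\<^sub>1 f\<^sub>2 * cnj (cinner g\<^sub>1 g\<^sub>2)))"

section \<open>Localized vectors\<close>

definition compact_symmetric_nbhd :: "'g::topological_group_add set \<Rightarrow> bool" where
  "compact_symmetric_nbhd Q \<longleftrightarrow> compact Q \<and> 0 \<in> interior Q \<and> uminus ` Q = Q"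

definition Linf_loc :: "'g::topological_space measure \<Rightarrow> ('g \<Rightarrow> complex) set" where
  "Linf_loc \<mu> =
     {F \<in> borel_measurable \<mu>. \<forall>K. compact K \<longrightarrow> (\<exists>C. AE x in \<mu>. x \<in> K \<longrightarrow> cmod (F x) \<le> C)}"

definition left_maximal ::
    "'g::topological_group_add measure \<Rightarrow> 'g set \<Rightarrow> ('g \<Rightarrow> complex) \<Rightarrow> 'g \<Rightarrow> ennreal" where
  "left_maximal \<mu> Q F x = esssup (restrict_space \<mu> Q) (\<lambda>z. ennreal (cmod (F (x + z))))"

definition wiener_L2 ::
    "'g::topological_group_add measure \<Rightarrow> 'g set \<Rightarrow> ('g \<Rightarrow> complex) set" where
  "wiener_L2 \<mu> Q =
     {F \<in> Linf_loc \<mu>. left_maximal \<mu> Q F \<in> borel_measurable \<mu> \<and>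
        (\<integral>\<^sup>+x. (left_maximal \<mu> Q F x)\<^sup>2 \<partial>\<mu>) < \<infinity>}"

definition localized_vectors ::
    "'g::topological_group_add measure \<Rightarrow> 'g set \<Rightarrow> ('g \<Rightarrow> 'h \<Rightarrow> 'h::complex_hilbert_space) \<Rightarrow> 'h set"
  where "localized_vectors \<mu> Q \<pi> = {g. matrix_coeff \<pi> g g \<in> wiener_L2 \<mu> Q}"

section \<open>Beurling densities\<close>

text \<open>The empty set has to be excluded from the test sets: for it, the first quotient is \<open>1\<close>.\<close>

definition strong_folner ::
    "'g::topological_group_add measure \<Rightarrow> (nat \<Rightarrow> 'g set) \<Rightarrow> bool" where
  "strong_folner \<mu> K \<longleftrightarrow>
     (\<forall>n. compact (K n) \<and> emeasure \<mu> (K n) > 0) \<and>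
     (\<forall>C. compact C \<and> C \<noteq> {} \<longrightarrow>
        (\<lambda>n. emeasure \<mu> (sym_diff (K n + C) (K n)) / emeasure \<mu> (K n)) \<longlonglongrightarrow> 0 \<and>
        (\<lambda>n. emeasure \<mu> ((K n + C) \<inter> ((UNIV - K n) + C)) / emeasure \<mu> (K n)) \<longlonglongrightarrow> 0)"

text \<open>
  The densities take the strong Foelner sequence as an argument; their values do not depend on it.
  They lie in \<open>[0, \<infinity>]\<close>, and points are counted in \<open>[0, \<infinity>]\<close>, as a discrete set need not meet every
  compact set in a finite set.
\<close>

definition lower_beurling_density ::
    "'g::topological_group_add measure \<Rightarrow> (nat \<Rightarrow> 'g set) \<Rightarrow> 'g set \<Rightarrow> ennreal" where
  "lower_beurling_density \<mu> K \<Lambda> =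
     lim (\<lambda>n. INF x. emeasure (count_space UNIV) (\<Lambda> \<inter> (\<lambda>a. x + a) ` K n) / emeasure \<mu> (K n))"

definition upper_beurling_density ::
    "'g::topological_group_add measure \<Rightarrow> (nat \<Rightarrow> 'g set) \<Rightarrow> 'g set \<Rightarrow> ennreal" where
  "upper_beurling_density \<mu> K \<Lambda> =
     lim (\<lambda>n. SUP x. emeasure (count_space UNIV) (\<Lambda> \<inter> (\<lambda>a. x + a) ` K n) / emeasure \<mu> (K n))"

end

(*
  Fix a compact set K. For a large compact set C, each vector pi(x) g with x in K has only a small
  part of its frame coefficients (square-summed) outside Lambda cap (K + C): this is where g in B^2
  enters, through the maximal function of V_g g. Applied to the frame indexed by Lambda - Gamma, with
  its canonical dual, it follows that all these vectors are close to one subspace of dimension at most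
  #((Lambda - Gamma) cap (K + C)). Integrating over x in K and using the orthogonality relations
  bounds this number below by d (1 - e) mu(K). For K = K_n in a strong Foelner sequence the points in
  (K_n + C) - K_n are negligible, so adding the points of Gamma yields
  D^+(Lambda) >= d + D^-(Gamma). The limits that define the densities exist by averaging the counts
  over translates of K_m.
*)
theory Submission
  imports Defs
begin

section \<open>Inner products\<close>

text \<open>The compact set C has to be fixed before K, because K runs through a Folner sequence
  afterwards. Invariance makes this possible: the cocycle has modulus 1, so the squared coefficient
  of \<open>\<pi> x g\<close> at \<open>\<pi> l g\<close> depends only on \<open>- x + l\<close>,
  and C restricts this difference alone. The dimension bound is a comparison of traces. An
  orthonormal set E spanning the approximating subspace captures the fraction 1 - e of the squared
  norm of \<open>\<pi> x g\<close> for almost every x in K, while each element of E has total mass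
  \<open>(norm g)\<^sup>2 / d\<close> over the whole group. The maximal function is an essential
  supremum, so it says nothing at a prescribed point \<open>- x + l\<close>. Averaging and Fubini
  give bounds for almost every x, which is enough since x is integrated over K. Discreteness alone
  permits infinitely many points in a compact set. The upper frame bound first gives uniformly
  bounded counts; finite-dimensional approximation, interchange of sums with integrals and the
  existence of the density limits all rest on them.\<close>

lemma cinner_add_right: "cinner x (y + z) = cinner x y + cinner x z"
  by (simp add: cinner_commute[of x] cinner_add_left)

lemma cinner_scaleC_right: "cinner x (c *\<^sub>C y) = cnj c * cinner x y"
  by (simp add: cinner_commute[of x] cinner_scaleC_left)

lemma cinner_scaleR_left: "cinner (r *\<^sub>R x) y = of_real r * cinner x y"
  using cinner_scaleC_left[of "of_real r" x y] by (simp only: scaleC_of_real)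

lemma cinner_scaleR_right: "cinner x (r *\<^sub>R y) = of_real r * cinner x y"
  using cinner_scaleC_right[of x "of_real r" y] by (simp only: scaleC_of_real complex_cnj_complex_of_real)

lemma cinner_zero_left [simp]: "cinner 0 y = 0"
  using cinner_add_left[of 0 0 y] by simp

lemma cinner_zero_right [simp]: "cinner x 0 = 0"
  by (simp add: cinner_commute[of x])

lemma cinner_minus_left: "cinner (- x) y = - cinner x y"
  using minus_unique[of "cinner x y" "cinner (- x) y"] cinner_add_left[of x "- x" y] by simp

lemma cinner_minus_right: "cinner x (- y) = - cinner x y"
  using minus_unique[of "cinner x y" "cinner x (- y)"] cinner_add_right[of x y "- y"] by simp

lemma cinner_diff_left: "cinner (x - y) z = cinner x z - cinner y z"
  using cinner_add_left[of x "- y" z] by (simp add: cinner_minus_left)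

lemma cinner_diff_right: "cinner x (y - z) = cinner x y - cinner x z"
  using cinner_add_right[of x y "- z"] by (simp add: cinner_minus_right)

lemma cinner_sum_left: "cinner (\<Sum>i\<in>I. f i) y = (\<Sum>i\<in>I. cinner (f i) y)"
  by (induction I rule: infinite_finite_induct) (auto simp: cinner_add_left)

lemma cinner_sum_right: "cinner x (\<Sum>i\<in>I. f i) = (\<Sum>i\<in>I. cinner x (f i))"
  by (induction I rule: infinite_finite_induct) (auto simp: cinner_add_right)

lemma scaleC_sum_left: "(\<Sum>i\<in>I. c i) *\<^sub>C x = (\<Sum>i\<in>I. c i *\<^sub>C x)"
  using scaleC_of_real[of 0 x]
  by (induction I rule: infinite_finite_induct) (auto simp: scaleC_add_left)

lemma scaleC_sum_right: "c *\<^sub>C (\<Sum>i\<in>I. x i) = (\<Sum>i\<in>I. c *\<^sub>C x i)"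
  using scaleC_add_right[of c 0 0]
  by (induction I rule: infinite_finite_induct) (auto simp: scaleC_add_right)

lemma norm_diff_square: "(norm (x - y))\<^sup>2 = (norm x)\<^sup>2 + (norm y)\<^sup>2 - 2 * Re (cinner x y)"
proof -
  have "complex_of_real ((norm (x - y))\<^sup>2) = cinner x x + cinner y y - (cinner x y + cnj (cinner x y))"
    unfolding cinner_self[symmetric]
    by (simp add: cinner_diff_left cinner_diff_right cinner_commute[of y x] algebra_simps)
  then have "Re (complex_of_real ((norm (x - y))\<^sup>2))
      = Re (cinner x x + cinner y y - (cinner x y + cnj (cinner x y)))"
    by (rule arg_cong)
  then show ?thesis
    by (simp add: cinner_self del: of_real_power)
qed

lemma norm_scaleC: "norm (c *\<^sub>C x) = cmod c * norm x"
proof -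
  have "complex_of_real ((norm (c *\<^sub>C x))\<^sup>2) = (c * cnj c) * cinner x x"
    unfolding cinner_self[symmetric]
    by (simp add: cinner_scaleC_left cinner_scaleC_right)
  also have "\<dots> = complex_of_real ((cmod c * norm x)\<^sup>2)"
    by (simp only: complex_norm_square[symmetric] cinner_self of_real_mult[symmetric] power_mult_distrib)
  finally have "(norm (c *\<^sub>C x))\<^sup>2 = (cmod c * norm x)\<^sup>2"
    using of_real_eq_iff by blast
  then show ?thesis
    by (simp add: power2_eq_iff_nonneg)
qed

lemma Cauchy_Schwarz_cinner: "cmod (cinner x y) \<le> norm x * norm y"
proof (cases "y = 0")
  case False
  \<comment> \<open>\<open>c\<close> is the coefficient of the orthogonal projection of
    \<open>x\<close> onto \<open>y\<close>; nonnegativity of the squared residual is the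
    inequality.\<close>
  define c where "c = cinner x y / complex_of_real ((norm y)\<^sup>2)"
  have c: "c * complex_of_real ((norm y)\<^sup>2) = cinner x y"
    using False by (simp add: c_def)
  have "0 \<le> (norm (x - c *\<^sub>C y))\<^sup>2" by simp
  also have "\<dots> = (norm x)\<^sup>2 + (cmod c)\<^sup>2 * (norm y)\<^sup>2 - 2 * Re (cnj c * cinner x y)"
    by (simp add: norm_diff_square norm_scaleC cinner_scaleC_right power_mult_distrib)
  also have "Re (cnj c * cinner x y) = (cmod c)\<^sup>2 * (norm y)\<^sup>2"
  proof -
    have "cnj c * cinner x y = (c * cnj c) * complex_of_real ((norm y)\<^sup>2)"
      by (simp only: c[symmetric] ac_simps)
    then have "cnj c * cinner x y = complex_of_real ((cmod c)\<^sup>2 * (norm y)\<^sup>2)"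
      by (simp only: complex_norm_square[symmetric] of_real_mult)
    then show ?thesis by (metis Re_complex_of_real)
  qed
  finally have "(cmod c)\<^sup>2 * (norm y)\<^sup>2 \<le> (norm x)\<^sup>2" by (simp add: mult.commute)
  moreover have "cmod (cinner x y) = cmod c * (norm y)\<^sup>2"
    using arg_cong[OF c, of cmod] by (simp add: norm_mult norm_power)
  moreover have "(cmod c * (norm y)\<^sup>2)\<^sup>2 = (cmod c)\<^sup>2 * (norm y)\<^sup>2 * (norm y)\<^sup>2"
    by (simp only: power2_eq_square ac_simps)
  ultimately have "(cmod (cinner x y))\<^sup>2 \<le> (norm x * norm y)\<^sup>2"
    by (simp only: power_mult_distrib mult_right_mono[OF _ zero_le_power2])
  then show ?thesis
    by (rule power2_le_imp_le) simp
qed simp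

lemma bounded_linear_cinner_left: "bounded_linear (\<lambda>x. cinner x y)"
  by (rule bounded_linear_intro[where K = "norm y"])
     (simp_all add: cinner_add_left cinner_scaleR_left Cauchy_Schwarz_cinner scaleR_conv_of_real)

lemma bounded_linear_cinner_right: "bounded_linear (\<lambda>y. cinner x y)"
  by (rule bounded_linear_intro[where K = "norm x"])
     (simp_all add: cinner_add_right cinner_scaleR_right scaleR_conv_of_real Cauchy_Schwarz_cinner
        mult.commute[of "norm _" "norm x"])

section \<open>Finite orthonormal systems and best approximation\<close>

definition orthonormal :: "'h::complex_hilbert_space set \<Rightarrow> bool" where
  "orthonormal E \<longleftrightarrow> (\<forall>e\<in>E. \<forall>e'\<in>E. cinner e e' = (if e = e' then 1 else 0))"

lemma orthonormal_norm: "orthonormal E \<Longrightarrow> e \<in> E \<Longrightarrow> norm e = 1"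
proof -
  assume "orthonormal E" "e \<in> E"
  then have "cinner e e = 1" by (auto simp: orthonormal_def)
  then have "complex_of_real ((norm e)\<^sup>2) = of_real 1" using cinner_self[of e] by simp
  then have "(norm e)\<^sup>2 = 1" using of_real_eq_iff by blast
  then show ?thesis using norm_ge_zero[of e] unfolding power2_eq_1_iff by linarith
qed

lemma orthonormal_cinner_expansion:
  assumes "orthonormal E" "finite E" "e \<in> E"
  shows "cinner (\<Sum>e'\<in>E. c e' *\<^sub>C e') e = c e"
proof -
  have "cinner (\<Sum>e'\<in>E. c e' *\<^sub>C e') e = (\<Sum>e'\<in>E. c e' * cinner e' e)"
    by (simp add: cinner_sum_left cinner_scaleC_left)
  also have "\<dots> = (\<Sum>e'\<in>E. if e' = e then c e' else 0)"
    using assms by (intro sum.cong) (auto simp: orthonormal_def)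
  also have "\<dots> = c e" using assms by simp
  finally show ?thesis .
qed

text \<open>Membership in the span of E is expressed by the Fourier expansion itself, the form in
  which it is used later. X may be linearly dependent: a vector with zero residual adds nothing to
  E, so only an inequality of cardinalities is available.\<close>

lemma Gram_Schmidt:
  fixes X :: "'h::complex_hilbert_space set"
  assumes "finite X"
  shows "\<exists>E. finite E \<and> card E \<le> card X \<and> orthonormal E \<and> (\<forall>x\<in>X. (\<Sum>e\<in>E. cinner x e *\<^sub>C e) = x)"
  using assms
proof (induction X)
  case empty
  show ?case by (intro exI[of _ "{}"]) (auto simp: orthonormal_def)
next
  case (insert x X)
  then obtain E where E: "finite E" "card E \<le> card X" "orthonormal E"
    "\<And>y. y \<in> X \<Longrightarrow> (\<Sum>e\<in>E. cinner y e *\<^sub>C e) = y" by blast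
  define p where "p = (\<Sum>e\<in>E. cinner x e *\<^sub>C e)"
  define u where "u = x - p"
  have ue: "cinner u e = 0" if "e \<in> E" for e
    using orthonormal_cinner_expansion[OF E(3,1) that, of "cinner x"]
    by (simp add: u_def p_def cinner_diff_left)
  show ?case
  proof (cases "u = 0")
    case True
    then have "(\<Sum>e\<in>E. cinner x e *\<^sub>C e) = x" by (simp add: u_def p_def)
    then show ?thesis using E insert.hyps
      by (intro exI[of _ E]) (auto simp: le_SucI)
  next
    case False
    define n where "n = norm u"
    define w where "w = complex_of_real (1 / n) *\<^sub>C u"
    have n: "n > 0" using False by (simp add: n_def)
    have we: "cinner w e = 0" if "e \<in> E" for e
      using ue[OF that] by (simp add: w_def cinner_scaleC_left)
    have ew: "cinner e w = 0" if "e \<in> E" for e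
      using we[OF that] cinner_commute[of e w] by simp
    have ww: "cinner w w = 1"
    proof -
      have "cinner w w = complex_of_real (1 / n) * (complex_of_real (1 / n) * cinner u u)"
        by (simp add: w_def cinner_scaleC_left cinner_scaleC_right)
      also have "\<dots> = complex_of_real (1 / n * (1 / n * n\<^sup>2))"
        by (simp only: cinner_self n_def[symmetric] of_real_mult)
      also have "1 / n * (1 / n * n\<^sup>2) = 1"
        using n by (simp add: power2_eq_square)
      finally show ?thesis by simp
    qed
    have wE: "w \<notin> E" using ew[of w] ww by auto
    have on: "orthonormal (insert w E)"
      using E(3) we ew ww wE by (auto simp: orthonormal_def)
    have nw: "complex_of_real n *\<^sub>C w = u"
    proof -
      have "complex_of_real n *\<^sub>C w = n *\<^sub>R ((1 / n) *\<^sub>R u)"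
        by (simp only: w_def scaleC_of_real)
      also have "\<dots> = u" using n by simp
      finally show ?thesis .
    qed
    have "cinner u w = n" 
      using ww nw by (metis cinner_scaleC_left mult.right_neutral)
    moreover have "cinner p w = 0"
      by (simp add: p_def cinner_sum_left cinner_scaleC_left ew)
    ultimately have "cinner x w = n"
      by (simp add: u_def cinner_diff_left)
    then have "(\<Sum>e\<in>insert w E. cinner x e *\<^sub>C e) = u + p"
      using E(1) wE nw by (simp add: p_def)
    then have x: "(\<Sum>e\<in>insert w E. cinner x e *\<^sub>C e) = x" by (simp add: u_def)
    have "(\<Sum>e\<in>insert w E. cinner y e *\<^sub>C e) = y" if "y \<in> X" for y
    proof -
      have "cinner y w = (\<Sum>e\<in>E. cinner y e * cinner e w)"
        by (subst E(4)[OF that, symmetric]) (simp add: cinner_sum_left cinner_scaleC_left)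
      then have "cinner y w = 0" by (simp add: ew)
      moreover have "0 *\<^sub>C w = 0" using scaleC_of_real[of 0 w] by simp
      ultimately show ?thesis using E(1) wE E(4)[OF that] by simp
    qed
    with x on E show ?thesis using insert.hyps wE
      by (intro exI[of _ "insert w E"]) auto
  qed
qed

text \<open>The left side is the squared distance from f to the span of E, and y lies in that span.
  Expanding \<open>norm (f - y)\<close> and using \<open>2 a b \<le> a\<^sup>2 + b\<^sup>2\<close>
  in each coordinate suffices.\<close>

lemma orthonormal_best_approximation:
  fixes E :: "'h::complex_hilbert_space set"
  assumes E: "orthonormal E" "finite E" and y: "(\<Sum>e\<in>E. cinner y e *\<^sub>C e) = y"
  shows "(norm f)\<^sup>2 - (\<Sum>e\<in>E. (cmod (cinner f e))\<^sup>2) \<le> (norm (f - y))\<^sup>2"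
proof -
  have fy: "cinner f y = (\<Sum>e\<in>E. cnj (cinner y e) * cinner f e)"
    by (subst y[symmetric]) (simp add: cinner_sum_right cinner_scaleC_right)
  have "cinner y y = (\<Sum>e\<in>E. cnj (cinner y e) * cinner y e)"
    by (subst (2) y[symmetric]) (simp add: cinner_sum_right cinner_scaleC_right)
  also have "\<dots> = (\<Sum>e\<in>E. complex_of_real ((cmod (cinner y e))\<^sup>2))"
    by (simp only: complex_norm_square[symmetric] mult.commute[of "cnj _"])
  finally have "complex_of_real ((norm y)\<^sup>2) = complex_of_real (\<Sum>e\<in>E. (cmod (cinner y e))\<^sup>2)"
    by (simp only: cinner_self of_real_sum)
  then have yy: "(norm y)\<^sup>2 = (\<Sum>e\<in>E. (cmod (cinner y e))\<^sup>2)"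
    using of_real_eq_iff by blast
  have "2 * Re (cinner f y) \<le> (\<Sum>e\<in>E. (cmod (cinner f e))\<^sup>2) + (\<Sum>e\<in>E. (cmod (cinner y e))\<^sup>2)"
    unfolding fy Re_sum sum_distrib_left sum.distrib[symmetric]
  proof (rule sum_mono)
    fix e
    have "2 * Re (cnj (cinner y e) * cinner f e) \<le> 2 * (cmod (cinner f e) * cmod (cinner y e))"
      by (metis complex_Re_le_cmod complex_mod_cnj mult.commute mult_left_mono norm_mult zero_le_numeral)
    also have "\<dots> \<le> (cmod (cinner f e))\<^sup>2 + (cmod (cinner y e))\<^sup>2"
      using sum_squares_bound[of "cmod (cinner f e)" "cmod (cinner y e)"] by simp
    finally show "2 * Re (cnj (cinner y e) * cinner f e) \<le> (cmod (cinner f e))\<^sup>2 + (cmod (cinner y e))\<^sup>2" .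
  qed
  then show ?thesis by (simp add: norm_diff_square yy)
qed

section \<open>Frames\<close>

lemma abs_Re_mult_le:
  fixes a b :: complex
  shows "\<bar>Re (a * cnj b)\<bar> \<le> ((cmod a)\<^sup>2 + (cmod b)\<^sup>2) / 2"
proof -
  have "\<bar>Re (a * cnj b)\<bar> \<le> cmod a * cmod b"
    using abs_Re_le_cmod[of "a * cnj b"] by (simp add: norm_mult)
  then show ?thesis using sum_squares_bound[of "cmod a" "cmod b"] by simp
qed

text \<open>Works with real sums instead of the \<open>ennreal\<close> sums of
  \<open>is_frame\<close>. A real \<open>infsum\<close> defaults to 0 on a family that is not
  summable, so summability has to be a separate axiom.\<close>

locale hilbert_frame =
  fixes I :: "'i set" and v :: "'i \<Rightarrow> 'h::complex_hilbert_space" and A B :: real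
  assumes lower_pos: "0 < A"
    and coeff_summable: "(\<lambda>i. (cmod (cinner f (v i)))\<^sup>2) summable_on I"
    and lower_bound: "A * (norm f)\<^sup>2 \<le> (\<Sum>\<^sub>\<infinity>i\<in>I. (cmod (cinner f (v i)))\<^sup>2)"
    and upper_bound: "(\<Sum>\<^sub>\<infinity>i\<in>I. (cmod (cinner f (v i)))\<^sup>2) \<le> B * (norm f)\<^sup>2"

text \<open>The upper bound on finite partial sums gives summability in the reals; after that the
  real and the \<open>ennreal\<close> sums are suprema of the same partial sums.\<close>

lemma is_frameE:
  assumes "is_frame I v"
  obtains A B where "hilbert_frame I v A B"
proof -
  obtain A B :: real where AB: "0 < A" "A \<le> B"
    and lo: "\<And>f. ennreal (A * (norm f)\<^sup>2) \<le> (\<Sum>\<^sub>\<infinity>i\<in>I. ennreal ((cmod (cinner f (v i)))\<^sup>2))"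
    and up: "\<And>f. (\<Sum>\<^sub>\<infinity>i\<in>I. ennreal ((cmod (cinner f (v i)))\<^sup>2)) \<le> ennreal (B * (norm f)\<^sup>2)"
    using assms unfolding is_frame_def by blast
  have fin: "(\<Sum>i\<in>F. (cmod (cinner f (v i)))\<^sup>2) \<le> B * (norm f)\<^sup>2" if "finite F" "F \<subseteq> I" for f F
  proof -
    have "ennreal (\<Sum>i\<in>F. (cmod (cinner f (v i)))\<^sup>2) = (\<Sum>i\<in>F. ennreal ((cmod (cinner f (v i)))\<^sup>2))"
      by (rule sum_ennreal[symmetric]) simp
    also have "\<dots> = (\<Sum>\<^sub>\<infinity>i\<in>F. ennreal ((cmod (cinner f (v i)))\<^sup>2))"
      using that by simp
    also have "\<dots> \<le> (\<Sum>\<^sub>\<infinity>i\<in>I. ennreal ((cmod (cinner f (v i)))\<^sup>2))"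
      using that by (intro infsum_mono_neutral) (auto simp: nonneg_summable_on_complete)
    also have "\<dots> \<le> ennreal (B * (norm f)\<^sup>2)" by (rule up)
    finally show ?thesis using AB by (subst (asm) ennreal_le_iff) auto
  qed
  have summ: "(\<lambda>i. (cmod (cinner f (v i)))\<^sup>2) summable_on I" for f
    using fin by (intro nonneg_bdd_above_summable_on bdd_aboveI[where M = "B * (norm f)\<^sup>2"]) auto
  have eq: "(\<Sum>\<^sub>\<infinity>i\<in>I. ennreal ((cmod (cinner f (v i)))\<^sup>2)) = ennreal (\<Sum>\<^sub>\<infinity>i\<in>I. (cmod (cinner f (v i)))\<^sup>2)" for f
  proof -
    have "ennreal (\<Sum>\<^sub>\<infinity>i\<in>I. (cmod (cinner f (v i)))\<^sup>2)
        = (SUP F\<in>{F. finite F \<and> F \<subseteq> I}. ennreal (\<Sum>i\<in>F. (cmod (cinner f (v i)))\<^sup>2))"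
      by (rule infsum_nonneg_is_SUPREMUM_ennreal[OF summ]) simp
    also have "\<dots> = (SUP F\<in>{F. finite F \<and> F \<subseteq> I}. \<Sum>i\<in>F. ennreal ((cmod (cinner f (v i)))\<^sup>2))"
      by (intro SUP_cong refl sum_ennreal[symmetric]) simp
    also have "\<dots> = (\<Sum>\<^sub>\<infinity>i\<in>I. ennreal ((cmod (cinner f (v i)))\<^sup>2))"
      by (subst nonneg_infsum_complete) auto
    finally show ?thesis by simp
  qed
  have "hilbert_frame I v A B"
  proof
    fix f
    have nn: "0 \<le> (\<Sum>\<^sub>\<infinity>i\<in>I. (cmod (cinner f (v i)))\<^sup>2)" by (rule infsum_nonneg) simp
    show "A * (norm f)\<^sup>2 \<le> (\<Sum>\<^sub>\<infinity>i\<in>I. (cmod (cinner f (v i)))\<^sup>2)"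
      using lo[of f] nn by (simp add: eq ennreal_le_iff)
    show "(\<Sum>\<^sub>\<infinity>i\<in>I. (cmod (cinner f (v i)))\<^sup>2) \<le> B * (norm f)\<^sup>2"
      using up[of f] AB by (simp add: eq ennreal_le_iff)
  qed (use AB summ in auto)
  then show ?thesis by (rule that)
qed

context hilbert_frame
begin

text \<open>This is \<open>\<langle>S f, f\<rangle>\<close> for the frame operator S; the lower
  frame bound says that it is coercive.\<close>

definition energy :: "'h \<Rightarrow> real" where
  "energy f = (\<Sum>\<^sub>\<infinity>i\<in>I. (cmod (cinner f (v i)))\<^sup>2)"

text \<open>The real part of the sesquilinear form of the frame operator.\<close>

definition form :: "'h \<Rightarrow> 'h \<Rightarrow> real" where
  "form h f = (\<Sum>\<^sub>\<infinity>i\<in>I. Re (cinner h (v i) * cnj (cinner f (v i))))"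

lemma form_summable: "(\<lambda>i. Re (cinner h (v i) * cnj (cinner f (v i)))) summable_on I"
proof (rule abs_summable_summable, rule summable_on_comparison_test)
  show "(\<lambda>i. (cmod (cinner h (v i)))\<^sup>2 + (cmod (cinner f (v i)))\<^sup>2) summable_on I"
    by (intro summable_on_add coeff_summable)
  fix i
  show "norm (Re (cinner h (v i) * cnj (cinner f (v i)))) \<le> (cmod (cinner h (v i)))\<^sup>2 + (cmod (cinner f (v i)))\<^sup>2"
    using abs_Re_mult_le[of "cinner h (v i)" "cinner f (v i)"]
      zero_le_power2[of "cmod (cinner h (v i))"] zero_le_power2[of "cmod (cinner f (v i))"]
    unfolding real_norm_def by argo
qed simp

text \<open>One expansion yields both the parallelogram identity (t = 1 and t = -1) and the first
  variation of the functional minimized below.\<close>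

lemma energy_add_scaleR: "energy (h + t *\<^sub>R f) = energy h + 2 * t * form h f + t\<^sup>2 * energy f"
proof -
  have "energy (h + t *\<^sub>R f) = (\<Sum>\<^sub>\<infinity>i\<in>I. ((cmod (cinner h (v i)))\<^sup>2
      + 2 * t * Re (cinner h (v i) * cnj (cinner f (v i)))) + t\<^sup>2 * (cmod (cinner f (v i)))\<^sup>2)"
    unfolding energy_def
    by (rule infsum_cong)
       (unfold cmod_power2, simp add: cinner_add_left cinner_scaleR_left power2_eq_square algebra_simps)
  then show ?thesis
    unfolding energy_def form_def
    by (simp add: infsum_add infsum_cmult_right' summable_on_add summable_on_cmult_right
        coeff_summable form_summable del: times_complex.sel)
qed

lemma form_add_left: "form (h + h') f = form h f + form h' f"
  unfolding form_def infsum_add[OF form_summable form_summable, symmetric]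
  by (simp add: cinner_add_left algebra_simps)

lemma form_diff_left: "form (h - h') f = form h f - form h' f"
  using form_add_left[of "h - h'" h' f] by simp

lemma form_zero_left [simp]: "form 0 f = 0"
  by (simp add: form_def)

lemma form_sum_left: "form (\<Sum>j\<in>J. h j) f = (\<Sum>j\<in>J. form (h j) f)"
  by (induction J rule: infinite_finite_induct) (auto simp: form_add_left)

text \<open>\<open>form\<close> keeps only a real part, so a complex scalar cannot be pulled out; it
  moves to the other argument, conjugated.\<close>

lemma form_scaleC_left: "form (c *\<^sub>C h) f = form h (cnj c *\<^sub>C f)"
  by (simp add: form_def cinner_scaleC_left ac_simps)

lemma form_self: "form h h = energy h"
  unfolding form_def energy_def
  by (rule infsum_cong) (simp add: complex_norm_square[symmetric] flip: of_real_power)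

text \<open>
  Riesz representation for the frame form, by minimizing \<open>energy h - 2 Re \<langle>u, h\<rangle>\<close>: minimizing
  sequences are Cauchy by the parallelogram law.
\<close>

lemma form_representation:
  obtains h where "\<And>f. form h f = Re (cinner u f)"
proof -
  define J where "J h = energy h - 2 * Re (cinner u h)" for h
  have lo: "A * (norm h)\<^sup>2 \<le> energy h" for h
    using lower_bound by (simp add: energy_def)
  have bdd: "bdd_below (range J)"
  \<comment> \<open>The bound comes from completing the square in
    \<open>A * (norm h)\<^sup>2 - 2 * norm u * norm h\<close>.\<close>
  proof (rule bdd_belowI[where m = "- (norm u)\<^sup>2 / A"])
    fix y assume "y \<in> range J"
    then obtain h where y: "y = J h" by auto
    have "Re (cinner u h) \<le> norm u * norm h"
      using complex_Re_le_cmod Cauchy_Schwarz_cinner order_trans by blast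
    moreover have "2 * (norm u * norm h) \<le> A * (norm h)\<^sup>2 + (norm u)\<^sup>2 / A"
    proof -
      have "0 \<le> (A * norm h - norm u)\<^sup>2 / A" using lower_pos by simp
      also have "\<dots> = A * (norm h)\<^sup>2 + (norm u)\<^sup>2 / A - 2 * (norm u * norm h)"
        using lower_pos by (simp add: power2_eq_square field_simps)
      finally show ?thesis by simp
    qed
    ultimately show "- (norm u)\<^sup>2 / A \<le> y" using lo[of h] by (simp add: y J_def)
  qed
  define m where "m = Inf (range J)"
  have m: "m \<le> J h" for h unfolding m_def by (rule cInf_lower[OF _ bdd]) simp
  have "\<exists>h. J h < m + inverse (real (Suc n))" for n
    using cInf_lessD[of "range J" "m + inverse (real (Suc n))"] by (auto simp: m_def)
  then obtain x where x: "\<And>n. J (x n) < m + inverse (real (Suc n))" by metis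
  \<comment> \<open>The linear terms cancel in
    \<open>2 J a + 2 J b - 4 J ((a + b) / 2) = energy (a - b)\<close>, and the midpoint value is at
    least m.\<close>
  have par: "energy (a - b) \<le> 2 * (J a - m) + 2 * (J b - m)" for a b
  proof -
    have e1: "energy (a - b) = energy a - 2 * form a b + energy b"
      using energy_add_scaleR[of a "-1" b] by simp
    have e2: "energy (a + b) = energy a + 2 * form a b + energy b"
      using energy_add_scaleR[of a 1 b] by simp
    have "energy ((1/2) *\<^sub>R (a + b)) = energy (a + b) / 4"
      using energy_add_scaleR[of 0 "1/2" "a + b"] by (simp add: power2_eq_square energy_def)
    then have "J ((1/2) *\<^sub>R (a + b)) = energy (a + b) / 4 - Re (cinner u a) - Re (cinner u b)"
      by (simp add: J_def cinner_scaleR_right cinner_add_right algebra_simps del: scaleR_half_double)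
    then show ?thesis using m[of "(1/2) *\<^sub>R (a + b)"] e1 e2 unfolding J_def[of a] J_def[of b] by argo
  qed
  have inv0: "(\<lambda>n. inverse (real (Suc n))) \<longlonglongrightarrow> 0" by (rule LIMSEQ_inverse_real_of_nat)
  have "Cauchy x"
  proof (rule metric_CauchyI)
    fix e :: real assume e: "0 < e"
    \<comment> \<open>Two terms, each doubled by \<open>par\<close>, must stay below
      \<open>A * e\<^sup>2\<close>, hence the quarter.\<close>
    then have "eventually (\<lambda>n. inverse (real (Suc n)) < A * e\<^sup>2 / 4) sequentially"
      using lower_pos by (intro order_tendstoD[OF inv0]) simp
    then obtain N where N: "\<And>n. n \<ge> N \<Longrightarrow> inverse (real (Suc n)) < A * e\<^sup>2 / 4"
      by (auto simp: eventually_sequentially)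
    have "dist (x k) (x n) < e" if "k \<ge> N" "n \<ge> N" for k n
    proof -
      have "A * (norm (x k - x n))\<^sup>2 < A * e\<^sup>2"
        using lo[of "x k - x n"] par[of "x k" "x n"] x[of k] x[of n] N[OF that(1)] N[OF that(2)]
        by argo
      then have "(norm (x k - x n))\<^sup>2 < e\<^sup>2" using lower_pos by simp
      then show ?thesis using e by (simp add: dist_norm power2_less_imp_less)
    qed
    then show "\<exists>N. \<forall>k\<ge>N. \<forall>n\<ge>N. dist (x k) (x n) < e" by blast
  qed
  then obtain h where h: "x \<longlonglongrightarrow> h" using Cauchy_convergent convergent_def by blast
  have cl: "(\<lambda>n. cinner (x n) y) \<longlonglongrightarrow> cinner h y" for y
    by (rule bounded_linear.tendsto[OF bounded_linear_cinner_left h])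
  have cr: "(\<lambda>n. cinner u (x n)) \<longlonglongrightarrow> cinner u h"
    by (rule bounded_linear.tendsto[OF bounded_linear_cinner_right h])
  \<comment> \<open>Lower semicontinuity of \<open>energy\<close>: each finite partial sum passes to
    the limit, and the bound is uniform in the finite set.\<close>
  have "energy h \<le> m + 2 * Re (cinner u h)"
    unfolding energy_def
  proof (rule infsum_le_finite_sums[OF coeff_summable])
    fix F assume F: "finite F" "F \<subseteq> I"
    show "(\<Sum>i\<in>F. (cmod (cinner h (v i)))\<^sup>2) \<le> m + 2 * Re (cinner u h)"
    proof (rule LIMSEQ_le)
      show "(\<lambda>n. \<Sum>i\<in>F. (cmod (cinner (x n) (v i)))\<^sup>2) \<longlonglongrightarrow> (\<Sum>i\<in>F. (cmod (cinner h (v i)))\<^sup>2)"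
        by (intro tendsto_intros cl)
      have "(\<lambda>n. m + inverse (real (Suc n)) + 2 * Re (cinner u (x n))) \<longlonglongrightarrow> m + 0 + 2 * Re (cinner u h)"
        by (intro tendsto_intros cr inv0)
      then show "(\<lambda>n. m + inverse (real (Suc n)) + 2 * Re (cinner u (x n))) \<longlonglongrightarrow> m + 2 * Re (cinner u h)"
        by simp
      have "(\<Sum>i\<in>F. (cmod (cinner (x n) (v i)))\<^sup>2) \<le> energy (x n)" for n
        unfolding energy_def by (rule finite_sum_le_infsum[OF coeff_summable F]) simp
      then show "\<exists>N. \<forall>n\<ge>N. (\<Sum>i\<in>F. (cmod (cinner (x n) (v i)))\<^sup>2)
          \<le> m + inverse (real (Suc n)) + 2 * Re (cinner u (x n))"
        using x by (intro exI[of _ 0]) (smt (verit) J_def)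
    qed
  qed
  then have min: "J h \<le> J y" for y using m[of y] by (simp add: J_def)
  have "form h f = Re (cinner u f)" for f
  proof (rule ccontr)
    define D where "D = form h f - Re (cinner u f)"
    assume "form h f \<noteq> Re (cinner u f)"
    then have D: "D \<noteq> 0" by (simp add: D_def)
    \<comment> \<open>The minimizer of \<open>2 * t * D + t\<^sup>2 * (energy f + 1)\<close>; the
      added 1 keeps the denominator positive when \<open>energy f = 0\<close>.\<close>
    define t where "t = - D / (energy f + 1)"
    have ef: "0 \<le> energy f" unfolding energy_def by (rule infsum_nonneg) simp
    have "J (h + t *\<^sub>R f) = J h + 2 * t * D + t\<^sup>2 * energy f"
      by (simp add: J_def D_def energy_add_scaleR cinner_add_right cinner_scaleR_right algebra_simps)
    then have "0 \<le> 2 * t * D + t\<^sup>2 * energy f" using min[of "h + t *\<^sub>R f"] by simp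
    also have "\<dots> \<le> 2 * t * D + t\<^sup>2 * (energy f + 1)"
      by (intro add_left_mono mult_left_mono) auto
    also have "\<dots> = - D\<^sup>2 / (energy f + 1)"
    proof -
      have "t * (energy f + 1) = - D" using ef by (simp add: t_def)
      then have "t\<^sup>2 * (energy f + 1) = t * - D" by (simp only: power2_eq_square mult.assoc)
      then show ?thesis by (simp add: t_def power2_eq_square)
    qed
    also have "\<dots> < 0" using ef D by (simp add: divide_neg_pos)
    finally show False by simp
  qed
  then show ?thesis by (rule that)
qed

text \<open>
  With the canonical dual vectors \<open>h i\<close>, the residual \<open>r = f - (\<Sum>i\<in>F. \<langle>f, v i\<rangle> h i)\<close> satisfies
  \<open>energy r = (\<Sum>i\<in>I - F. \<langle>f, v i\<rangle> \<langle>v i, r\<rangle>)\<close>, and AM-GM bounds this by half of the tail plus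
  half of \<open>energy r\<close>.
\<close>

lemma finite_approximation:
  assumes F: "finite F" "F \<subseteq> I"
  obtains E where "finite E" "card E \<le> card F" "orthonormal E"
    "\<And>f. A * ((norm f)\<^sup>2 - (\<Sum>e\<in>E. (cmod (cinner f e))\<^sup>2)) \<le> (\<Sum>\<^sub>\<infinity>i\<in>I - F. (cmod (cinner f (v i)))\<^sup>2)"
proof -
  have "\<forall>i. \<exists>h. \<forall>f. form h f = Re (cinner (v i) f)"
    using form_representation by metis
  then obtain h where h: "\<And>i f. form (h i) f = Re (cinner (v i) f)" by metis
  \<comment> \<open>E depends only on the dual vectors with index in F. It is fixed before f, so the
    same E serves every f.\<close>
  obtain E where E: "finite E" "card E \<le> card (h ` F)" "orthonormal E"
    "\<And>x. x \<in> h ` F \<Longrightarrow> (\<Sum>e\<in>E. cinner x e *\<^sub>C e) = x"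
    using Gram_Schmidt[of "h ` F"] F by auto
  show ?thesis
  proof (rule that[OF E(1) _ E(3)])
    show "card E \<le> card F" using E(2) card_image_le[OF F(1), of h] by simp
    fix f
    define y where "y = (\<Sum>i\<in>F. cinner f (v i) *\<^sub>C h i)"
    define r where "r = f - y"
    have y: "(\<Sum>e\<in>E. cinner y e *\<^sub>C e) = y"
    proof -
      have "(\<Sum>e\<in>E. cinner y e *\<^sub>C e) = (\<Sum>e\<in>E. \<Sum>i\<in>F. cinner f (v i) *\<^sub>C (cinner (h i) e *\<^sub>C e))"
        by (simp add: y_def cinner_sum_left cinner_scaleC_left scaleC_sum_left scaleC_scaleC)
      also have "\<dots> = (\<Sum>i\<in>F. \<Sum>e\<in>E. cinner f (v i) *\<^sub>C (cinner (h i) e *\<^sub>C e))"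
        by (rule sum.swap)
      also have "\<dots> = (\<Sum>i\<in>F. cinner f (v i) *\<^sub>C h i)"
        by (simp add: E(4) flip: scaleC_sum_right)
      finally show ?thesis by (simp add: y_def)
    qed
    define w where "w i = Re (cinner f (v i) * cnj (cinner r (v i)))" for i
    have fy: "form y r = (\<Sum>i\<in>F. w i)"
      by (simp add: y_def form_sum_left form_scaleC_left h cinner_scaleC_right w_def
          flip: cinner_commute)
    have half_summable: "(\<lambda>i. 1/2 * (cmod (cinner x (v i)))\<^sup>2) summable_on I - F" for x
      by (intro summable_on_cmult_right summable_on_subset[OF coeff_summable]) auto
    have tail: "(\<Sum>\<^sub>\<infinity>i\<in>I - F. (cmod (cinner r (v i)))\<^sup>2) \<le> energy r"
      unfolding energy_def by (rule infsum_mono2) (auto intro: coeff_summable summable_on_subset[OF coeff_summable])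
    have "energy r = form f r - form y r"
      by (metis form_self form_diff_left r_def)
    also have "form f r = (\<Sum>\<^sub>\<infinity>i\<in>I. w i)" by (simp add: form_def w_def)
    also have "\<dots> - form y r = (\<Sum>\<^sub>\<infinity>i\<in>I - F. w i)"
      unfolding fy using F form_summable[of f r, folded w_def]
      by (subst infsum_Diff) (auto simp: w_def[abs_def])
    also have "\<dots> \<le> (\<Sum>\<^sub>\<infinity>i\<in>I - F. 1/2 * (cmod (cinner f (v i)))\<^sup>2 + 1/2 * (cmod (cinner r (v i)))\<^sup>2)"
    proof (rule infsum_mono)
      show "w summable_on I - F"
        using form_summable[of f r] unfolding w_def by (rule summable_on_subset) auto
      show "(\<lambda>i. 1/2 * (cmod (cinner f (v i)))\<^sup>2 + 1/2 * (cmod (cinner r (v i)))\<^sup>2) summable_on I - F"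
        by (intro summable_on_add half_summable)
      show "w i \<le> 1/2 * (cmod (cinner f (v i)))\<^sup>2 + 1/2 * (cmod (cinner r (v i)))\<^sup>2" for i
        using abs_Re_mult_le[of "cinner f (v i)" "cinner r (v i)"] unfolding w_def by argo
    qed
    also have "\<dots> = 1/2 * (\<Sum>\<^sub>\<infinity>i\<in>I - F. (cmod (cinner f (v i)))\<^sup>2)
        + 1/2 * (\<Sum>\<^sub>\<infinity>i\<in>I - F. (cmod (cinner r (v i)))\<^sup>2)"
      by (simp only: infsum_add[OF half_summable half_summable] infsum_cmult_right')
    finally have "energy r \<le> (\<Sum>\<^sub>\<infinity>i\<in>I - F. (cmod (cinner f (v i)))\<^sup>2)" using tail by simp
    moreover have "A * (norm r)\<^sup>2 \<le> energy r" using lower_bound by (simp add: energy_def)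
    moreover have "A * ((norm f)\<^sup>2 - (\<Sum>e\<in>E. (cmod (cinner f e))\<^sup>2)) \<le> A * (norm r)\<^sup>2"
      unfolding r_def using lower_pos orthonormal_best_approximation[OF E(3,1) y, of f] by simp
    ultimately show "A * ((norm f)\<^sup>2 - (\<Sum>e\<in>E. (cmod (cinner f e))\<^sup>2))
        \<le> (\<Sum>\<^sub>\<infinity>i\<in>I - F. (cmod (cinner f (v i)))\<^sup>2)" by linarith
  qed
qed

end

section \<open>Topological groups and Haar measure\<close>

text \<open>Written as preimages, translates inherit openness and measurability from the continuity
  of translation.\<close>

lemma image_add_eq_vimage:
  fixes x :: "'g::group_add"
  shows "(\<lambda>a. x + a) ` S = (\<lambda>a. - x + a) -` S" "(\<lambda>a. a + x) ` S = (\<lambda>a. a + - x) -` S"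
proof -
  show "(\<lambda>a. x + a) ` S = (\<lambda>a. - x + a) -` S"
  proof (intro set_eqI iffI)
    fix y assume "y \<in> (\<lambda>a. - x + a) -` S"
    then show "y \<in> (\<lambda>a. x + a) ` S"
      by (intro image_eqI[where x = "- x + y"]) (simp_all flip: add.assoc)
  qed (auto simp flip: add.assoc)
  show "(\<lambda>a. a + x) ` S = (\<lambda>a. a + - x) -` S"
  proof (intro set_eqI iffI)
    fix y assume "y \<in> (\<lambda>a. a + - x) -` S"
    then show "y \<in> (\<lambda>a. a + x) ` S"
      by (intro image_eqI[where x = "y + - x"]) (simp_all add: add.assoc)
  qed (auto simp: add.assoc)
qed

lemma mem_translate_iff: "(z::'g::group_add) \<in> (\<lambda>a. y + a) ` L \<longleftrightarrow> - y + z \<in> L"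
  by (auto simp: image_add_eq_vimage)

lemma continuous_on_uminus_group:
  fixes S :: "'g::topological_group_add set"
  shows "continuous_on S uminus"
  unfolding continuous_on_def by (intro ballI tendsto_minus tendsto_ident_at)

lemma borel_measurable_group_minus [measurable (raw)]:
  fixes f :: "'a \<Rightarrow> 'g::{topological_group_add, second_countable_topology}"
  assumes "f \<in> borel_measurable M"
  shows "(\<lambda>x. - f x) \<in> borel_measurable M"
  by (rule borel_measurable_continuous_on[OF continuous_on_uminus_group assms])

lemma open_translation_group:
  fixes S :: "'g::topological_group_add set"
  assumes "open S"
  shows "open ((\<lambda>a. x + a) ` S)" "open ((\<lambda>a. a + x) ` S)"
  unfolding image_add_eq_vimage
  by (intro open_vimage assms continuous_intros)+

lemma open_set_plus_left:
  fixes S T :: "'g::topological_group_add set"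
  assumes "open S"
  shows "open (S + T)"
proof -
  have "S + T = (\<Union>t\<in>T. (\<lambda>a. a + t) ` S)" by (auto simp: set_plus_def)
  then show ?thesis using open_translation_group(2)[OF assms] by auto
qed

lemma compact_set_plus:
  fixes S T :: "'g::topological_group_add set"
  assumes "compact S" "compact T"
  shows "compact (S + T)"
proof -
  have "S + T = (\<lambda>p. fst p + snd p) ` (S \<times> T)" by (force simp: set_plus_def)
  then show ?thesis
    using assms by (auto intro!: compact_continuous_image compact_Times continuous_intros)
qed

lemma compact_uminus_group:
  fixes S :: "'g::topological_group_add set"
  shows "compact S \<Longrightarrow> compact (uminus ` S)"
  by (rule compact_continuous_image[OF continuous_on_uminus_group])

lemma compact_translation_group:
  fixes S :: "'g::topological_group_add set"
  shows "compact S \<Longrightarrow> compact ((\<lambda>a. x + a) ` S)"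
  by (rule compact_continuous_image) (auto intro!: continuous_intros)

section \<open>Integration on a second-countable unimodular group\<close>

locale unimodular_haar =
  fixes \<mu> :: "'g::{topological_group_add, t2_space, second_countable_topology} measure"
  assumes loc_compact: "locally compact (UNIV :: 'g set)"
    and haar: "haar_measure \<mu>"
    and unimod: "unimodular \<mu>"
begin

lemma sets_mu [simp, measurable_cong]: "sets \<mu> = sets borel"
  using haar by (simp add: haar_measure_def)

lemma space_mu [simp]: "space \<mu> = UNIV"
  using sets_eq_imp_space_eq[OF sets_mu] by simp

lemma compact_measurable: "compact C \<Longrightarrow> C \<in> sets \<mu>"
  by (simp add: compact_imp_closed)

lemma finite_compact: "compact C \<Longrightarrow> emeasure \<mu> C < \<infinity>"
  using haar by (simp add: haar_measure_def)

lemma emeasure_left: "A \<in> sets borel \<Longrightarrow> emeasure \<mu> ((\<lambda>a. x + a) ` A) = emeasure \<mu> A"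
  using haar by (simp add: haar_measure_def)

lemma emeasure_right: "A \<in> sets borel \<Longrightarrow> emeasure \<mu> ((\<lambda>a. a + x) ` A) = emeasure \<mu> A"
  using unimod by (simp add: unimodular_def)

lemma distr_left: "distr \<mu> \<mu> (\<lambda>a. x + a) = \<mu>"
proof (rule measure_eqI)
  fix A assume "A \<in> sets (distr \<mu> \<mu> (\<lambda>a. x + a))"
  then have A: "A \<in> sets borel" by simp
  have "emeasure (distr \<mu> \<mu> (\<lambda>a. x + a)) A = emeasure \<mu> ((\<lambda>a. x + a) -` A)"
    using A by (subst emeasure_distr) auto
  also have "(\<lambda>a. x + a) -` A = (\<lambda>a. - x + a) ` A"
    using image_add_eq_vimage(1)[of "- x" A] by simp
  finally show "emeasure (distr \<mu> \<mu> (\<lambda>a. x + a)) A = emeasure \<mu> A"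
    using A by (simp add: emeasure_left)
qed simp

lemma distr_right: "distr \<mu> \<mu> (\<lambda>a. a + x) = \<mu>"
proof (rule measure_eqI)
  fix A assume "A \<in> sets (distr \<mu> \<mu> (\<lambda>a. a + x))"
  then have A: "A \<in> sets borel" by simp
  have "emeasure (distr \<mu> \<mu> (\<lambda>a. a + x)) A = emeasure \<mu> ((\<lambda>a. a + x) -` A)"
    using A by (subst emeasure_distr) auto
  also have "(\<lambda>a. a + x) -` A = (\<lambda>a. a + - x) ` A"
    using image_add_eq_vimage(2)[of "- x" A] by simp
  finally show "emeasure (distr \<mu> \<mu> (\<lambda>a. a + x)) A = emeasure \<mu> A"
    using A emeasure_right[of A "- x"] by simp
qed simp

lemma nn_integral_left:
  assumes "f \<in> borel_measurable borel"
  shows "(\<integral>\<^sup>+a. f (x + a) \<partial>\<mu>) = (\<integral>\<^sup>+a. f a \<partial>\<mu>)"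
proof -
  have "(\<integral>\<^sup>+a. f a \<partial>distr \<mu> \<mu> (\<lambda>a. x + a)) = (\<integral>\<^sup>+a. f (x + a) \<partial>\<mu>)"
    using assms by (intro nn_integral_distr) auto
  then show ?thesis by (simp only: distr_left)
qed

lemma nn_integral_right:
  assumes "f \<in> borel_measurable borel"
  shows "(\<integral>\<^sup>+a. f (a + x) \<partial>\<mu>) = (\<integral>\<^sup>+a. f a \<partial>\<mu>)"
proof -
  have "(\<integral>\<^sup>+a. f a \<partial>distr \<mu> \<mu> (\<lambda>a. a + x)) = (\<integral>\<^sup>+a. f (a + x) \<partial>\<mu>)"
    using assms by (intro nn_integral_distr) auto
  then show ?thesis by (simp only: distr_right)
qed

lemma compact_neighbourhood:
  fixes x :: 'g
  obtains U C where "open U" "x \<in> U" "U \<subseteq> C" "compact C"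
proof -
  obtain U C where "openin (top_of_set UNIV) U" "compact C" "x \<in> U" "U \<subseteq> C"
    using locallyE[OF loc_compact, of UNIV x] by auto
  then show ?thesis using that by simp
qed

text \<open>By Lindelof, countably many open sets contained in compact sets cover the group; finite
  unions of the enclosing compact sets exhaust it.\<close>

lemma compact_exhaustion:
  obtains C :: "nat \<Rightarrow> 'g set"
  where "\<And>n. compact (C n)" "incseq C" "(\<Union>n. C n) = UNIV"
proof -
  define \<F> where "\<F> = {U :: 'g set. open U \<and> (\<exists>C. compact C \<and> U \<subseteq> C)}"
  obtain \<G> where \<G>: "\<G> \<subseteq> \<F>" "countable \<G>" "\<Union>\<G> = \<Union>\<F>"
    using Lindelof[of \<F>] unfolding \<F>_def by blast
  have "y \<in> \<Union>\<F>" for y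
  proof -
    obtain U D :: "'g set" where "open U" "y \<in> U" "U \<subseteq> D" "compact D"
      by (rule compact_neighbourhood)
    then show ?thesis by (auto simp: \<F>_def)
  qed
  then have "\<Union>\<F> = UNIV" by auto
  then have "\<Union>\<G> = UNIV" using \<G> by simp
  \<comment> \<open>\<open>from_nat_into\<close> enumerates a countable set, possibly with
    repetitions, but stays inside it only if the set is nonempty.\<close>
  then have ne: "\<G> \<noteq> {}" by auto
  have "\<forall>U\<in>\<G>. \<exists>C. compact C \<and> U \<subseteq> C" using \<G>(1) unfolding \<F>_def by blast
  then obtain c where c: "\<And>U. U \<in> \<G> \<Longrightarrow> compact (c U) \<and> U \<subseteq> c U" by metis
  define C where "C n = (\<Union>k\<le>n. c (from_nat_into \<G> k))" for n
  have "compact (C n)" for n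
    unfolding C_def using c from_nat_into[OF ne] by (intro compact_UN) auto
  moreover have "incseq C"
    unfolding C_def incseq_def by (auto intro: order_trans)
  moreover have "(\<Union>n. C n) = UNIV"
  proof -
    have "y \<in> (\<Union>n. C n)" for y
    proof -
      obtain U where U: "U \<in> \<G>" "y \<in> U" using \<open>\<Union>\<G> = UNIV\<close> by (metis UNIV_I UnionE)
      then obtain n where "from_nat_into \<G> n = U"
        using from_nat_into_surj[OF \<G>(2)] by blast
      then show ?thesis using U c unfolding C_def by blast
    qed
    then show ?thesis by auto
  qed
  ultimately show ?thesis by (rule that)
qed

lemma sigma_finite_mu: "sigma_finite_measure \<mu>"
proof -
  obtain C :: "nat \<Rightarrow> 'g set" where C: "\<And>n. compact (C n)" "incseq C" "(\<Union>n. C n) = UNIV"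
    by (rule compact_exhaustion) blast
  show ?thesis
  proof (intro sigma_finite_measure.intro exI[of _ "range C"] conjI ballI)
    fix D assume "D \<in> range C"
    then have "compact D" using C(1) by auto
    then show "emeasure \<mu> D \<noteq> \<infinity>" using finite_compact[of D] by auto
  next
    show "range C \<subseteq> sets \<mu>" using compact_measurable[OF C(1)] by auto
  qed (use C(3) in simp_all)
qed

sublocale sigma_finite_measure \<mu> by (rule sigma_finite_mu)

sublocale mu2: pair_sigma_finite \<mu> \<mu> ..

text \<open>The translates of U cover the group and, by Lindelof, countably many of them suffice. If
  U were null, the whole measure would vanish.\<close>

lemma emeasure_open_pos:
  assumes "open U" "U \<noteq> {}"
  shows "emeasure \<mu> U > 0"
proof (rule ccontr)
  assume "\<not> emeasure \<mu> U > 0"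
  then have U0: "emeasure \<mu> U = 0" by (simp add: zero_less_iff_neq_zero)
  obtain u where u: "u \<in> U" using assms by auto
  define \<F> where "\<F> = range (\<lambda>x. (\<lambda>a. x + a) ` U)"
  obtain \<G> where \<G>: "\<G> \<subseteq> \<F>" "countable \<G>" "\<Union>\<G> = \<Union>\<F>"
    using Lindelof[of \<F>] open_translation_group(1)[OF assms(1)] unfolding \<F>_def by blast
  have "y \<in> \<Union>\<F>" for y
  proof -
    have "y = (y + - u) + u" by (simp add: add.assoc)
    then show ?thesis using u unfolding \<F>_def by blast
  qed
  then have "\<Union>\<G> = UNIV" using \<G>(3) by auto
  moreover have "\<Union>\<G> \<in> null_sets \<mu>"
  proof -
    have "V \<in> null_sets \<mu>" if V_in: "V \<in> \<G>" for V
    proof -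
      obtain x where V: "V = (\<lambda>a. x + a) ` U" using V_in \<G>(1) unfolding \<F>_def by blast
      have "U \<in> sets borel" using assms by simp
      then show ?thesis
        using open_translation_group(1)[OF assms(1), of x] U0 emeasure_left[of U x]
        by (auto simp: V null_sets_def)
    qed
    then show ?thesis using null_sets_UN'[OF \<G>(2), of "\<lambda>V. V" \<mu>] by simp
  qed
  ultimately have "emeasure \<mu> UNIV = 0" by (simp add: null_sets_def)
  then show False using haar by (simp add: haar_measure_def)
qed

text \<open>
  Computing \<open>\<integral>\<integral> 1\<^sub>C(x) 1\<^sub>B(- x + y) dx dy\<close> in both orders gives \<open>\<mu> C * \<mu> B = \<mu> C * \<mu> (- B)\<close>.
\<close>

lemma emeasure_uminus:
  assumes B [measurable]: "B \<in> sets borel"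
  shows "emeasure \<mu> (uminus -` B) = emeasure \<mu> B"
proof -
  \<comment> \<open>C serves as a factor of nonzero finite measure, so that it can be cancelled in
    \<open>ennreal\<close> at the end.\<close>
  obtain U C :: "'g set" where UC: "open U" "0 \<in> U" "U \<subseteq> C" "compact C"
    by (rule compact_neighbourhood)
  have [measurable]: "C \<in> sets borel" using compact_measurable[OF UC(4)] by simp
  have Bm [measurable]: "uminus -` B \<in> sets borel"
    using measurable_sets_borel[OF borel_measurable_group_minus[OF measurable_ident] B] by simp
  have "emeasure \<mu> U > 0" using UC by (intro emeasure_open_pos) auto
  then have Cpos: "emeasure \<mu> C \<noteq> 0" using emeasure_mono[OF UC(3), of \<mu>] by auto
  have "emeasure \<mu> C * emeasure \<mu> B = (\<integral>\<^sup>+x. indicator C x * emeasure \<mu> B \<partial>\<mu>)"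
    by (simp add: nn_integral_multc)
  also have "\<dots> = (\<integral>\<^sup>+x. \<integral>\<^sup>+y. indicator C x * indicator B (- x + y) \<partial>\<mu> \<partial>\<mu>)"
  proof (intro nn_integral_cong)
    fix x
    have "(\<integral>\<^sup>+y. indicator C x * indicator B (- x + y) \<partial>\<mu>) = indicator C x * (\<integral>\<^sup>+y. indicator B (- x + y) \<partial>\<mu>)"
      by (rule nn_integral_cmult) measurable
    also have "(\<integral>\<^sup>+y. indicator B (- x + y) \<partial>\<mu>) = emeasure \<mu> B"
      by (subst nn_integral_left[of "indicator B" "- x"]) auto
    finally show "indicator C x * emeasure \<mu> B = (\<integral>\<^sup>+y. indicator C x * indicator B (- x + y) \<partial>\<mu>)"
      by simp
  qed
  also have "\<dots> = (\<integral>\<^sup>+y. \<integral>\<^sup>+x. indicator C x * indicator B (- x + y) \<partial>\<mu> \<partial>\<mu>)"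
    by (intro mu2.Fubini'[symmetric]) measurable
  \<comment> \<open>The substitution \<open>x = y + u\<close> is left invariance; integrating
    \<open>indicator C (y + u)\<close> over y afterwards is right invariance, so unimodularity
    enters here.\<close>
  also have "\<dots> = (\<integral>\<^sup>+y. \<integral>\<^sup>+u. indicator C (y + u) * indicator B (- u) \<partial>\<mu> \<partial>\<mu>)"
  proof (rule nn_integral_cong)
    fix y
    have "(\<integral>\<^sup>+x. indicator C x * indicator B (- x + y) \<partial>\<mu>)
        = (\<integral>\<^sup>+u. indicator C (y + u) * indicator B (- (y + u) + y) \<partial>\<mu>)"
      by (rule nn_integral_left[symmetric]) measurable
    also have "\<dots> = (\<integral>\<^sup>+u. indicator C (y + u) * indicator B (- u) \<partial>\<mu>)"
      by (simp add: minus_add add.assoc)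
    finally show "(\<integral>\<^sup>+x. indicator C x * indicator B (- x + y) \<partial>\<mu>)
        = (\<integral>\<^sup>+u. indicator C (y + u) * indicator B (- u) \<partial>\<mu>)" .
  qed
  also have "\<dots> = (\<integral>\<^sup>+u. \<integral>\<^sup>+y. indicator C (y + u) * indicator B (- u) \<partial>\<mu> \<partial>\<mu>)"
    by (intro mu2.Fubini') measurable
  also have "\<dots> = (\<integral>\<^sup>+u. emeasure \<mu> C * indicator B (- u) \<partial>\<mu>)"
  proof (intro nn_integral_cong)
    fix u
    have "(\<integral>\<^sup>+y. indicator C (y + u) * indicator B (- u) \<partial>\<mu>)
        = (\<integral>\<^sup>+y. indicator C (y + u) \<partial>\<mu>) * indicator B (- u)"
      by (rule nn_integral_multc) measurable
    also have "(\<integral>\<^sup>+y. indicator C (y + u) \<partial>\<mu>) = emeasure \<mu> C"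
      by (subst nn_integral_right[of "indicator C" u]) auto
    finally show "(\<integral>\<^sup>+y. indicator C (y + u) * indicator B (- u) \<partial>\<mu>) = emeasure \<mu> C * indicator B (- u)" .
  qed
  also have "\<dots> = emeasure \<mu> C * (\<integral>\<^sup>+u. indicator B (- u) \<partial>\<mu>)"
    by (rule nn_integral_cmult) measurable
  also have "(\<integral>\<^sup>+u. indicator B (- u) \<partial>\<mu>) = (\<integral>\<^sup>+u. indicator (uminus -` B) u \<partial>\<mu>)"
    by (intro nn_integral_cong) (auto simp: indicator_def)
  also have "\<dots> = emeasure \<mu> (uminus -` B)"
    by (rule nn_integral_indicator) (simp add: Bm)
  finally show ?thesis
    using Cpos finite_compact[OF UC(4)] by (auto simp: ennreal_mult_cancel_left)
qed

lemma distr_uminus: "distr \<mu> \<mu> uminus = \<mu>"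
proof (rule measure_eqI)
  have [measurable]: "(uminus :: 'g \<Rightarrow> 'g) \<in> borel_measurable borel"
    by (rule borel_measurable_group_minus) measurable
  fix A assume "A \<in> sets (distr \<mu> \<mu> uminus)"
  then have A: "A \<in> sets borel" by simp
  then show "emeasure (distr \<mu> \<mu> uminus) A = emeasure \<mu> A"
    by (subst emeasure_distr) (auto simp: emeasure_uminus)
qed simp

lemma nn_integral_uminus:
  assumes "f \<in> borel_measurable borel"
  shows "(\<integral>\<^sup>+a. f (- a) \<partial>\<mu>) = (\<integral>\<^sup>+a. f a \<partial>\<mu>)"
proof -
  have [measurable]: "(uminus :: 'g \<Rightarrow> 'g) \<in> borel_measurable borel"
    by (rule borel_measurable_group_minus) measurable
  have "(\<integral>\<^sup>+a. f a \<partial>distr \<mu> \<mu> uminus) = (\<integral>\<^sup>+a. f (- a) \<partial>\<mu>)"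
    using assms by (intro nn_integral_distr) auto
  then show ?thesis by (simp only: distr_uminus)
qed

text \<open>In the counting arguments a point l is fixed and the base point of a translate varies,
  so the variable enters through \<open>- a + x\<close>. Inversion followed by a right translation
  removes it.\<close>

lemma nn_integral_reflect:
  assumes [measurable]: "f \<in> borel_measurable borel"
  shows "(\<integral>\<^sup>+a. f (- a + x) \<partial>\<mu>) = (\<integral>\<^sup>+a. f a \<partial>\<mu>)"
proof -
  have "(\<integral>\<^sup>+a. f (- a + x) \<partial>\<mu>) = (\<integral>\<^sup>+a. f (a + x) \<partial>\<mu>)"
    by (rule nn_integral_uminus[of "\<lambda>a. f (a + x)"]) measurable
  also have "\<dots> = (\<integral>\<^sup>+a. f a \<partial>\<mu>)" by (rule nn_integral_right) measurable
  finally show ?thesis .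
qed

lemma AE_left:
  assumes "AE q in \<mu>. P q"
  shows "AE z in \<mu>. P (w + z)"
proof -
  have "\<exists>N\<in>null_sets \<mu>. {z. \<not> P z} \<subseteq> N"
    using assms by (simp add: eventually_ae_filter)
  then obtain N where N: "N \<in> null_sets \<mu>" "{z. \<not> P z} \<subseteq> N" ..
  have Nb: "N \<in> sets borel" using null_setsD2[OF N(1)] by simp
  have "(\<lambda>a. w + a) -` N = (\<lambda>a. - w + a) ` N"
    using image_add_eq_vimage(1)[of "- w" N] by simp
  then have "emeasure \<mu> ((\<lambda>a. w + a) -` N) = 0"
    using emeasure_left[OF Nb, of "- w"] null_setsD1[OF N(1)] by simp
  moreover have "(\<lambda>a. w + a) -` N \<in> sets \<mu>"
    using measurable_sets_borel[OF _ Nb, of "\<lambda>a. w + a"] by simp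
  ultimately have "(\<lambda>a. w + a) -` N \<in> null_sets \<mu>" by (rule null_setsI)
  then show ?thesis by (rule AE_I') (use N(2) in auto)
qed

lemma AE_reflect:
  assumes "AE z in \<mu>. P z"
  shows "AE a in \<mu>. P (- a + x)"
proof -
  have "\<exists>N\<in>null_sets \<mu>. {z. \<not> P z} \<subseteq> N"
    using assms by (simp add: eventually_ae_filter)
  then obtain N where N: "N \<in> null_sets \<mu>" "{z. \<not> P z} \<subseteq> N" ..
  have [measurable]: "N \<in> sets borel" using null_setsD2[OF N(1)] by simp
  have "emeasure \<mu> {a. - a + x \<in> N} = (\<integral>\<^sup>+a. indicator {a. - a + x \<in> N} a \<partial>\<mu>)"
    by (rule nn_integral_indicator[symmetric]) measurable
  also have "\<dots> = (\<integral>\<^sup>+a. indicator N (- a + x) \<partial>\<mu>)"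
    by (intro nn_integral_cong) (simp add: indicator_def)
  also have "\<dots> = emeasure \<mu> N" by (subst nn_integral_reflect) auto
  finally have "{a. - a + x \<in> N} \<in> null_sets \<mu>"
    using null_setsD1[OF N(1)] by (intro null_setsI) simp_all
  then show ?thesis by (rule AE_I') (use N(2) in auto)
qed

text \<open>Along a compact exhaustion the integrands cut off to the complements decrease to 0; the
  finite integral permits exchanging infimum and integral.\<close>

lemma small_tail:
  fixes f :: "'g \<Rightarrow> ennreal"
  assumes [measurable]: "f \<in> borel_measurable borel" and fin: "(\<integral>\<^sup>+x. f x \<partial>\<mu>) < \<infinity>" and "0 < e"
  obtains C where "compact C" "(\<integral>\<^sup>+x. f x * indicator (- C) x \<partial>\<mu>) < e"
proof -
  obtain C :: "nat \<Rightarrow> 'g set" where C: "\<And>n. compact (C n)" "incseq C" "(\<Union>n. C n) = UNIV"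
    by (rule compact_exhaustion) blast
  have [measurable]: "C n \<in> sets borel" for n using compact_measurable[OF C(1)] by simp
  define F where "F n x = f x * indicator (- C n) x" for n x
  have "(\<integral>\<^sup>+x. (INF n. F n x) \<partial>\<mu>) = (INF n. \<integral>\<^sup>+x. F n x \<partial>\<mu>)"
  proof (rule nn_integral_monotone_convergence_INF_decseq)
    show "decseq F"
      using C(2) by (intro decseq_SucI le_funI) (auto simp: F_def dest: incseq_SucD split: split_indicator)
    show "F n \<in> borel_measurable \<mu>" for n unfolding F_def by measurable
    have "(\<integral>\<^sup>+x. F 0 x \<partial>\<mu>) \<le> (\<integral>\<^sup>+x. f x \<partial>\<mu>)"
      by (intro nn_integral_mono) (auto simp: F_def split: split_indicator)
    then show "(\<integral>\<^sup>+x. F 0 x \<partial>\<mu>) < \<infinity>" using fin by (rule order_le_less_trans)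
  qed
  moreover have "(INF n. F n x) = 0" for x
  proof -
    obtain n where "x \<in> C n" using C(3) by auto
    then have "F n x = 0" by (simp add: F_def)
    then have "(INF n. F n x) \<le> 0" by (metis INF_lower UNIV_I)
    then show ?thesis by simp
  qed
  ultimately have "(INF n. \<integral>\<^sup>+x. F n x \<partial>\<mu>) < e" using \<open>0 < e\<close> by simp
  then obtain n where "(\<integral>\<^sup>+x. F n x \<partial>\<mu>) < e" unfolding INF_less_iff by auto
  then show ?thesis using that[OF C(1)[of n]] by (simp add: F_def)
qed

end

section \<open>Relatively separated sets and Beurling densities\<close>

abbreviation pts :: "'a set \<Rightarrow> ennreal" where
  "pts S \<equiv> emeasure (count_space UNIV) S"

text \<open>The bound N may depend on C but not on the translate.\<close>

definition relatively_separated :: "'g::topological_group_add set \<Rightarrow> bool" where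
  "relatively_separated \<Lambda> \<longleftrightarrow>
     (\<forall>C. compact C \<longrightarrow> (\<exists>N::nat. \<forall>y. pts (\<Lambda> \<inter> (\<lambda>a. y + a) ` C) \<le> of_nat N))"

lemma pts_mono: "S \<subseteq> T \<Longrightarrow> pts S \<le> pts T"
  by (rule emeasure_mono) auto

lemma pts_Un_le: "pts (S \<union> T) \<le> pts S + pts T"
  by (rule emeasure_subadditive) auto

text \<open>Turns counts into integrals for the counting measure, so that they can be interchanged
  with integrals over the group.\<close>

lemma pts_Int_eq_nn_integral: "pts (\<Lambda> \<inter> S) = (\<integral>\<^sup>+l. indicator S l \<partial>count_space \<Lambda>)"
proof -
  have "pts (\<Lambda> \<inter> S) = (\<integral>\<^sup>+l. indicator (\<Lambda> \<inter> S) l \<partial>count_space UNIV)"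
    by (rule nn_integral_indicator[symmetric]) simp
  also have "\<dots> = (\<integral>\<^sup>+l. indicator S l * indicator \<Lambda> l \<partial>count_space UNIV)"
    by (intro nn_integral_cong) (auto simp: indicator_def)
  also have "\<dots> = (\<integral>\<^sup>+l. indicator S l \<partial>count_space \<Lambda>)"
    by (rule nn_integral_count_space_indicator[symmetric]) simp
  finally show ?thesis .
qed

lemma ennreal_le_divideI:
  fixes a b c :: ennreal
  assumes "0 < c" "c < \<infinity>" "a * c \<le> b"
  shows "a \<le> b / c"
proof -
  have "a = a * c / c" using assms(1,2) by (subst mult_divide_eq_ennreal) auto
  also have "\<dots> \<le> b / c" using assms(3) by (rule divide_right_mono_ennreal)
  finally show ?thesis .
qed

lemma relatively_separated_subset:
  assumes "relatively_separated \<Lambda>" "\<Gamma> \<subseteq> \<Lambda>"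
  shows "relatively_separated \<Gamma>"
  unfolding relatively_separated_def
proof (intro allI impI)
  fix C :: "'a set" assume "compact C"
  then obtain N :: nat where N: "\<And>y. pts (\<Lambda> \<inter> (\<lambda>a. y + a) ` C) \<le> of_nat N"
    using assms(1) unfolding relatively_separated_def by metis
  have "pts (\<Gamma> \<inter> (\<lambda>a. y + a) ` C) \<le> of_nat N" for y
    using assms(2) by (intro order_trans[OF pts_mono N[of y]]) auto
  then show "\<exists>N::nat. \<forall>y. pts (\<Gamma> \<inter> (\<lambda>a. y + a) ` C) \<le> of_nat N" by auto
qed

lemma pts_le_of_natD: "pts S \<le> of_nat N \<Longrightarrow> finite S"
  by (rule ccontr) (simp add: top_unique)

text \<open>Countability allows swapping sums over \<open>\<Lambda>\<close> with integrals and
  collecting one null set per point into a single null set.\<close>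

lemma (in unimodular_haar) relatively_separated_countable:
  fixes \<Lambda> :: "'g set"
  assumes "relatively_separated \<Lambda>"
  shows "countable \<Lambda>"
proof -
  obtain C :: "nat \<Rightarrow> 'g set" where C: "\<And>n. compact (C n)" "incseq C" "(\<Union>n. C n) = UNIV"
    by (rule compact_exhaustion) blast
  have "finite (\<Lambda> \<inter> C n)" for n
  proof -
    obtain N :: nat where N: "\<forall>y. pts (\<Lambda> \<inter> (\<lambda>a. y + a) ` C n) \<le> of_nat N"
      using assms C(1)[of n] unfolding relatively_separated_def by auto
    have "pts (\<Lambda> \<inter> (\<lambda>a. 0 + a) ` C n) \<le> of_nat N" by (rule N[rule_format])
    then have "finite (\<Lambda> \<inter> (\<lambda>a. 0 + a) ` C n)" by (rule pts_le_of_natD)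
    then show ?thesis by simp
  qed
  then have "countable (\<Union>n. \<Lambda> \<inter> C n)"
    by (rule countable_UN[OF countableI_type countable_finite])
  then show ?thesis using C(3) by (simp only: Int_UN_distrib[symmetric] Int_UNIV_right)
qed

text \<open>For fixed m, letting n grow shows that \<open>u m\<close> is at most the lower limit of
  u; hence so is the supremum, which bounds every term from above.\<close>

lemma tendsto_SUP_if_almost_increasing:
  fixes u :: "nat \<Rightarrow> ennreal"
  assumes le: "\<And>m n. u m \<le> u n + \<delta> m n" and \<delta>: "\<And>m. (\<lambda>n. \<delta> m n) \<longlonglongrightarrow> 0"
  shows "u \<longlonglongrightarrow> (SUP n. u n)"
proof (rule order_tendstoI)
  fix a assume "a < (SUP n. u n)"
  then obtain m where m: "a < u m" by (auto simp: less_SUP_iff)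
  \<comment> \<open>The error is added to a instead of subtracted from \<open>u m\<close>, since
    subtraction in \<open>ennreal\<close> truncates.\<close>
  have "(\<lambda>n. a + \<delta> m n) \<longlonglongrightarrow> a + 0" by (intro tendsto_add tendsto_const \<delta>)
  then have "eventually (\<lambda>n. a + \<delta> m n < u m) sequentially"
    using m by (intro order_tendstoD(2)) auto
  then show "eventually (\<lambda>n. a < u n) sequentially"
  proof eventually_elim
    case (elim n)
    show ?case
    proof (rule ccontr)
      assume "\<not> a < u n"
      then have "u n + \<delta> m n \<le> a + \<delta> m n" by (intro add_right_mono) simp
      then show False using le[of m n] elim by (meson leD order_trans)
    qed
  qed
next
  fix a assume "(SUP n. u n) < a"
  then have "u n < a" for n by (meson SUP_upper UNIV_I order_le_less_trans)
  then show "eventually (\<lambda>n. u n < a) sequentially" by simp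
qed

text \<open>For fixed m the upper limit of u is at most \<open>u m\<close>; finiteness of
  \<open>u m\<close> is used to pass to the limit in the product.\<close>

lemma tendsto_INF_if_almost_decreasing:
  fixes u :: "nat \<Rightarrow> ennreal"
  assumes le: "\<And>m n. u n \<le> u m * r m n" and r: "\<And>m. (\<lambda>n. r m n) \<longlonglongrightarrow> 1"
    and fin: "\<And>m. u m < \<infinity>"
  shows "u \<longlonglongrightarrow> (INF n. u n)"
proof (rule order_tendstoI)
  fix a assume "(INF n. u n) < a"
  then obtain m where m: "u m < a" by (auto simp: INF_less_iff)
  have "(\<lambda>n. u m * r m n) \<longlonglongrightarrow> u m * 1"
    using fin[of m] by (intro ennreal_tendsto_cmult r) simp
  then have "eventually (\<lambda>n. u m * r m n < a) sequentially"
    using m by (intro order_tendstoD(2)) auto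
  then show "eventually (\<lambda>n. u n < a) sequentially"
    by eventually_elim (rule order_le_less_trans[OF le])
next
  fix a assume "a < (INF n. u n)"
  then have "a < u n" for n by (meson INF_lower UNIV_I order_less_le_trans)
  then show "eventually (\<lambda>n. a < u n) sequentially" by simp
qed

section \<open>Averaging point counts over translates\<close>

context unimodular_haar
begin

lemma nn_integral_count_swap:
  fixes \<Lambda> :: "'g set"
  assumes "relatively_separated \<Lambda>" and "\<And>l. (\<lambda>y. f l y) \<in> borel_measurable borel"
  shows "(\<integral>\<^sup>+y. \<integral>\<^sup>+l. f l y \<partial>count_space \<Lambda> \<partial>\<mu>) = (\<integral>\<^sup>+l. \<integral>\<^sup>+y. f l y \<partial>\<mu> \<partial>count_space \<Lambda>)"
  using assms by (intro nn_integral_count_space_nn_integral relatively_separated_countable) auto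

lemma nn_integral_reflect_indicator:
  fixes L :: "'g set"
  assumes "compact L"
  shows "(\<integral>\<^sup>+y. indicator L (- y + l) \<partial>\<mu>) = emeasure \<mu> L"
proof -
  have [measurable]: "L \<in> sets borel" using compact_measurable[OF assms] by simp
  have "(\<integral>\<^sup>+y. indicator L (- y + l) \<partial>\<mu>) = (\<integral>\<^sup>+y. indicator L y \<partial>\<mu>)"
    by (rule nn_integral_reflect) measurable
  then show ?thesis by simp
qed

text \<open>Integrate the count in \<open>y + L\<close> over y in \<open>x + K\<close>. Every point
  counted lies in \<open>x + (K + L)\<close>, and each point is counted for a set of y of measure at
  most \<open>\<mu> L\<close>.\<close>

lemma pts_lower_averaging:
  fixes \<Lambda> :: "'g set"
  assumes \<Lambda>: "relatively_separated \<Lambda>" and K: "compact K" and L: "compact L"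
    and s: "\<And>y. s \<le> pts (\<Lambda> \<inter> (\<lambda>a. y + a) ` L)"
  shows "s * emeasure \<mu> K \<le> pts (\<Lambda> \<inter> (\<lambda>a. x + a) ` (K + L)) * emeasure \<mu> L"
proof -
  have [measurable]: "K \<in> sets borel" "L \<in> sets borel"
    using compact_measurable[OF K] compact_measurable[OF L] by simp_all
  have "s * emeasure \<mu> K = s * emeasure \<mu> ((\<lambda>a. x + a) ` K)"
    by (subst emeasure_left) auto
  also have "\<dots> = (\<integral>\<^sup>+y. s * indicator ((\<lambda>a. x + a) ` K) y \<partial>\<mu>)"
    using compact_measurable[OF compact_translation_group[OF K, of x]]
    by (subst nn_integral_cmult_indicator) auto
  also have "\<dots> \<le> (\<integral>\<^sup>+y. \<integral>\<^sup>+l. indicator ((\<lambda>a. x + a) ` (K + L)) l * indicator L (- y + l) \<partial>count_space \<Lambda> \<partial>\<mu>)"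
  proof (rule nn_integral_mono)
    fix y
    show "s * indicator ((\<lambda>a. x + a) ` K) y
      \<le> (\<integral>\<^sup>+l. indicator ((\<lambda>a. x + a) ` (K + L)) l * indicator L (- y + l) \<partial>count_space \<Lambda>)"
    proof (cases "y \<in> (\<lambda>a. x + a) ` K")
      case True
      then obtain k where k: "k \<in> K" "y = x + k" by auto
      have "s \<le> (\<integral>\<^sup>+l. indicator ((\<lambda>a. y + a) ` L) l \<partial>count_space \<Lambda>)"
        using s[of y] by (simp only: pts_Int_eq_nn_integral)
      also have "\<dots> \<le> (\<integral>\<^sup>+l. indicator ((\<lambda>a. x + a) ` (K + L)) l * indicator L (- y + l) \<partial>count_space \<Lambda>)"
      proof (rule nn_integral_mono)
        fix l
        have "l \<in> (\<lambda>a. x + a) ` (K + L)" if "l \<in> (\<lambda>a. y + a) ` L"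
          using that k by (auto simp: set_plus_def add.assoc)
        then show "indicator ((\<lambda>a. y + a) ` L) l
            \<le> indicator ((\<lambda>a. x + a) ` (K + L)) l * (indicator L (- y + l) :: ennreal)"
          by (auto simp: mem_translate_iff split: split_indicator)
      qed
      finally show ?thesis using True by simp
    qed simp
  qed
  also have "\<dots> = (\<integral>\<^sup>+l. \<integral>\<^sup>+y. indicator ((\<lambda>a. x + a) ` (K + L)) l * indicator L (- y + l) \<partial>\<mu> \<partial>count_space \<Lambda>)"
    by (intro nn_integral_count_swap \<Lambda>) measurable
  also have "\<dots> = (\<integral>\<^sup>+l. indicator ((\<lambda>a. x + a) ` (K + L)) l * emeasure \<mu> L \<partial>count_space \<Lambda>)"
    by (rule nn_integral_cong) (simp add: nn_integral_cmult nn_integral_reflect_indicator[OF L])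
  also have "\<dots> = pts (\<Lambda> \<inter> (\<lambda>a. x + a) ` (K + L)) * emeasure \<mu> L"
    by (simp add: pts_Int_eq_nn_integral nn_integral_multc)
  finally show ?thesis .
qed

text \<open>A point l of \<open>x + K\<close> belongs to \<open>y + L\<close> for a set of y of
  measure exactly \<open>\<mu> L\<close>, and all these y lie in \<open>x + (K - L)\<close>, where
  each translate holds at most s points.\<close>

lemma pts_upper_averaging:
  fixes \<Lambda> :: "'g set"
  assumes \<Lambda>: "relatively_separated \<Lambda>" and K: "compact K" and L: "compact L"
    and s: "\<And>y. pts (\<Lambda> \<inter> (\<lambda>a. y + a) ` L) \<le> s"
  shows "pts (\<Lambda> \<inter> (\<lambda>a. x + a) ` K) * emeasure \<mu> L \<le> s * emeasure \<mu> (K + uminus ` L)"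
proof -
  have KL: "compact (K + uminus ` L)" by (intro compact_set_plus compact_uminus_group K L)
  have [measurable]: "K + uminus ` L \<in> sets borel" "L \<in> sets borel"
    using compact_measurable[OF KL] compact_measurable[OF L] by simp_all
  have "pts (\<Lambda> \<inter> (\<lambda>a. x + a) ` K) * emeasure \<mu> L
      = (\<integral>\<^sup>+l. indicator ((\<lambda>a. x + a) ` K) l * emeasure \<mu> L \<partial>count_space \<Lambda>)"
    by (simp add: pts_Int_eq_nn_integral nn_integral_multc)
  also have "\<dots> = (\<integral>\<^sup>+l. \<integral>\<^sup>+y. indicator ((\<lambda>a. x + a) ` K) l * indicator L (- y + l) \<partial>\<mu> \<partial>count_space \<Lambda>)"
    by (rule nn_integral_cong) (simp add: nn_integral_cmult nn_integral_reflect_indicator[OF L])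
  also have "\<dots> = (\<integral>\<^sup>+y. \<integral>\<^sup>+l. indicator ((\<lambda>a. x + a) ` K) l * indicator L (- y + l) \<partial>count_space \<Lambda> \<partial>\<mu>)"
    by (intro nn_integral_count_swap[symmetric] \<Lambda>) measurable
  also have "\<dots> \<le> (\<integral>\<^sup>+y. s * indicator ((\<lambda>a. x + a) ` (K + uminus ` L)) y \<partial>\<mu>)"
  proof (rule nn_integral_mono)
    fix y
    show "(\<integral>\<^sup>+l. indicator ((\<lambda>a. x + a) ` K) l * indicator L (- y + l) \<partial>count_space \<Lambda>)
        \<le> s * indicator ((\<lambda>a. x + a) ` (K + uminus ` L)) y"
    proof (cases "y \<in> (\<lambda>a. x + a) ` (K + uminus ` L)")
      case True
      have "(\<integral>\<^sup>+l. indicator ((\<lambda>a. x + a) ` K) l * indicator L (- y + l) \<partial>count_space \<Lambda>)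
          \<le> (\<integral>\<^sup>+l. indicator ((\<lambda>a. y + a) ` L) l \<partial>count_space \<Lambda>)"
        by (intro nn_integral_mono) (auto simp: mem_translate_iff split: split_indicator)
      also have "\<dots> \<le> s" using s[of y] by (simp only: pts_Int_eq_nn_integral)
      finally show ?thesis using True by simp
    next
      case False
      have eq: "indicator ((\<lambda>a. x + a) ` K) l * indicator L (- y + l) = (0::ennreal)" for l
      proof (rule ccontr)
        assume "indicator ((\<lambda>a. x + a) ` K) l * indicator L (- y + l) \<noteq> (0::ennreal)"
        then have "- x + l \<in> K" "- y + l \<in> L"
          by (auto simp: mem_translate_iff split: split_indicator_asm)
        then have "(- x + l) + - (- y + l) \<in> K + uminus ` L" by (intro set_plus_intro) auto
        then have "- x + y \<in> K + uminus ` L" by (simp add: minus_add add.assoc)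
        then show False using False by (simp add: mem_translate_iff)
      qed
      show ?thesis unfolding eq by simp
    qed
  qed
  also have "\<dots> = s * emeasure \<mu> ((\<lambda>a. x + a) ` (K + uminus ` L))"
    using compact_measurable[OF compact_translation_group[OF KL, of x]]
    by (subst nn_integral_cmult_indicator) auto
  also have "\<dots> = s * emeasure \<mu> (K + uminus ` L)"
    by (subst emeasure_left) auto
  finally show ?thesis .
qed

text \<open>
  If \<open>l \<in> x + (K + C)\<close> lies outside \<open>x + K\<close>, then \<open>l + Q\<close> lies in the translate by \<open>x\<close> of the
  thickened boundary of \<open>K\<close>; these sets overlap boundedly often.
\<close>

lemma pts_boundary:
  fixes \<Lambda> C Q :: "'g set"
  assumes \<Lambda>: "relatively_separated \<Lambda>" and C: "compact C" and Q: "compact_symmetric_nbhd Q"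
  obtains D c where "compact D" "D \<noteq> {}" "c < \<infinity>"
    "\<And>K x. compact K \<Longrightarrow> pts (\<Lambda> \<inter> (\<lambda>a. x + a) ` ((K + C) - K))
        \<le> c * emeasure \<mu> ((K + D) \<inter> ((UNIV - K) + D))"
proof -
  have cQ: "compact Q" and Q0: "0 \<in> interior Q" and sQ: "uminus ` Q = Q"
    using Q by (simp_all add: compact_symmetric_nbhd_def)
  have [measurable]: "Q \<in> sets borel" using compact_measurable[OF cQ] by simp
  have Qne: "Q \<noteq> {}" using Q0 interior_subset by auto
  have "emeasure \<mu> (interior Q) > 0" using Q0 by (intro emeasure_open_pos) auto
  then have Qpos: "emeasure \<mu> Q > 0"
    using emeasure_mono[OF interior_subset, of Q \<mu>] by (auto intro: order_less_le_trans)
  have Qfin: "emeasure \<mu> Q < \<infinity>" by (rule finite_compact[OF cQ])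
  obtain N :: nat where N: "\<forall>y. pts (\<Lambda> \<inter> (\<lambda>a. y + a) ` Q) \<le> of_nat N"
    using \<Lambda> cQ unfolding relatively_separated_def by auto
  \<comment> \<open>For l in the boundary region and y in \<open>l + Q\<close>, the part
    \<open>C + Q\<close> puts y into the thickened K, and the part \<open>Q\<close> puts y into the
    thickened complement of K.\<close>
  define D where "D = (C + Q) \<union> Q"
  have D: "compact D" unfolding D_def by (intro compact_Un compact_set_plus C cQ)
  show ?thesis
  proof (rule that[OF D])
    show "D \<noteq> {}" using Qne by (auto simp: D_def)
    have "of_nat N / emeasure \<mu> Q \<noteq> top"
      using Qpos by (auto simp: ennreal_divide_eq_top_iff)
    then show "of_nat N / emeasure \<mu> Q < \<infinity>"
      by (simp only: infinity_ennreal_def less_top)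
    fix K :: "'g set" and x assume K: "compact K"
    define T where "T = (K + D) \<inter> ((UNIV - K) + D)"
    have "open (UNIV - K)" using K by (simp add: compact_imp_closed open_Diff)
    then have "open ((UNIV - K) + D)" by (rule open_set_plus_left)
    moreover have "closed (K + D)" by (intro compact_imp_closed compact_set_plus K D)
    ultimately have T [measurable]: "T \<in> sets borel" unfolding T_def by auto
    have xT [measurable]: "(\<lambda>a. x + a) ` T \<in> sets borel"
    proof -
      have "(\<lambda>a. x + a) ` T = (\<lambda>a. - x + a) -` T" by (rule image_add_eq_vimage)
      also have "\<dots> = (\<lambda>a. - x + a) -` T \<inter> space borel" by simp
      also have "\<dots> \<in> sets borel" by (rule measurable_sets[OF _ T]) measurable
      finally show ?thesis .
    qed
    let ?B = "(\<lambda>a. x + a) ` ((K + C) - K)"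
    have "pts (\<Lambda> \<inter> ?B) * emeasure \<mu> Q = (\<integral>\<^sup>+l. indicator ?B l * emeasure \<mu> Q \<partial>count_space \<Lambda>)"
      by (simp add: pts_Int_eq_nn_integral nn_integral_multc)
    also have "\<dots> = (\<integral>\<^sup>+l. \<integral>\<^sup>+y. indicator ?B l * indicator Q (- y + l) \<partial>\<mu> \<partial>count_space \<Lambda>)"
      by (rule nn_integral_cong) (simp add: nn_integral_cmult nn_integral_reflect_indicator[OF cQ])
    also have "\<dots> = (\<integral>\<^sup>+y. \<integral>\<^sup>+l. indicator ?B l * indicator Q (- y + l) \<partial>count_space \<Lambda> \<partial>\<mu>)"
      by (intro nn_integral_count_swap[symmetric] \<Lambda>) measurable
    also have "\<dots> \<le> (\<integral>\<^sup>+y. of_nat N * indicator ((\<lambda>a. x + a) ` T) y \<partial>\<mu>)"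
    proof (rule nn_integral_mono)
      fix y
      show "(\<integral>\<^sup>+l. indicator ?B l * indicator Q (- y + l) \<partial>count_space \<Lambda>)
          \<le> of_nat N * indicator ((\<lambda>a. x + a) ` T) y"
      proof (cases "y \<in> (\<lambda>a. x + a) ` T")
        case True
        have "(\<integral>\<^sup>+l. indicator ?B l * indicator Q (- y + l) \<partial>count_space \<Lambda>)
            \<le> (\<integral>\<^sup>+l. indicator ((\<lambda>a. y + a) ` Q) l \<partial>count_space \<Lambda>)"
          by (intro nn_integral_mono) (auto simp: mem_translate_iff split: split_indicator)
        also have "\<dots> \<le> of_nat N"
          using N[rule_format, of y] by (simp only: pts_Int_eq_nn_integral)
        finally show ?thesis using True by simp
      next
        case False
        have eq: "indicator ?B l * indicator Q (- y + l) = (0::ennreal)" for l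
        proof (rule ccontr)
          assume "indicator ?B l * indicator Q (- y + l) \<noteq> (0::ennreal)"
          then have l: "- x + l \<in> K + C" "- x + l \<notin> K" and "- y + l \<in> Q"
            by (auto simp: mem_translate_iff split: split_indicator_asm)
          \<comment> \<open>Symmetry of Q converts l in \<open>y + Q\<close> into y in
            \<open>l + Q\<close>.\<close>
          then have "- (- y + l) \<in> uminus ` Q" by (intro imageI)
          then have q: "- l + y \<in> Q" by (simp add: sQ minus_add)
          obtain k c where kc: "k \<in> K" "c \<in> C" "- x + l = k + c"
            using l(1) by (auto elim: set_plus_elim)
          have e: "- x + y = (- x + l) + (- l + y)" by (simp add: add.assoc)
          have "k + (c + (- l + y)) \<in> K + D"
            using kc q unfolding D_def by (intro set_plus_intro UnI1)
          then have "- x + y \<in> K + D" by (simp add: e kc(3) add.assoc)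
          moreover have "- x + y \<in> (UNIV - K) + D"
            unfolding e using l(2) q unfolding D_def by (intro set_plus_intro UnI2) auto
          ultimately show False using False by (simp add: mem_translate_iff T_def)
        qed
        show ?thesis unfolding eq by simp
      qed
    qed
    also have "\<dots> = of_nat N * emeasure \<mu> T"
      by (subst nn_integral_cmult_indicator) (auto simp: emeasure_left)
    finally have "pts (\<Lambda> \<inter> ?B) \<le> of_nat N * emeasure \<mu> T / emeasure \<mu> Q"
      by (rule ennreal_le_divideI[OF Qpos Qfin])
    also have "\<dots> = of_nat N / emeasure \<mu> Q * emeasure \<mu> T"
      by (simp only: ennreal_times_divide mult.commute)
    finally show "pts (\<Lambda> \<inter> ?B) \<le> of_nat N / emeasure \<mu> Q * emeasure \<mu> ((K + D) \<inter> ((UNIV - K) + D))"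
      by (simp only: T_def)
  qed
qed

end

lemma ennreal_mult_right_le_cancel:
  fixes a b c :: ennreal
  assumes "0 < c" "c < \<infinity>" "a * c \<le> b * c"
  shows "a \<le> b"
proof -
  have "a \<le> b * c / c" using assms by (rule ennreal_le_divideI)
  also have "\<dots> = b" using assms(1,2) by (subst mult_divide_eq_ennreal) auto
  finally show ?thesis .
qed

lemma ennreal_mult_leI_divide:
  fixes a b c :: ennreal
  assumes "0 < c" "c < \<infinity>" "a \<le> b / c"
  shows "a * c \<le> b"
proof -
  have "a * c \<le> b / c * c" using assms(3) by (rule mult_right_mono) simp
  also have "\<dots> = c * b / c" by (simp only: ennreal_times_divide mult.commute)
  also have "\<dots> = b" using assms(1,2) by (subst mult.commute, subst mult_divide_eq_ennreal) auto
  finally show ?thesis .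
qed

lemma ennreal_le_INF_add_const:
  fixes a c :: ennreal
  assumes "\<And>i. a \<le> f i + c"
  shows "a \<le> (INF i. f i) + c"
proof -
  have "(INF i. f i) + c = (INF x\<in>range f. x + c)"
    using continuous_at_Inf_mono[of "\<lambda>x. x + c" "range f"]
      continuous_add[of "at_right (Inf (range f))", of "\<lambda>x. x" "\<lambda>x. c"]
    by (auto simp: mono_def image_comp)
  then show ?thesis using assms by (simp add: INF_greatest image_comp)
qed

section \<open>Existence of the densities along a strong Folner sequence\<close>

context unimodular_haar
begin

context
  fixes K :: "nat \<Rightarrow> 'g set"
  assumes folner: "strong_folner \<mu> K"
begin

lemma folner_compact: "compact (K n)"
  using folner by (simp add: strong_folner_def)

lemma folner_pos: "0 < emeasure \<mu> (K n)"
  using folner by (simp add: strong_folner_def)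

lemma folner_finite: "emeasure \<mu> (K n) < \<infinity>"
  by (rule finite_compact[OF folner_compact])

lemma folner_nonempty: "K n \<noteq> {}"
  using folner_pos[of n] by auto

text \<open>The points gained by enlarging \<open>K n\<close> are controlled by the thickened
  boundary, which the second Folner condition makes negligible. The error is the same for all
  translates x.\<close>

lemma folner_boundary_density:
  fixes \<Lambda> C Q :: "'g set"
  assumes \<Lambda>: "relatively_separated \<Lambda>" and C: "compact C" and Q: "compact_symmetric_nbhd Q"
  obtains \<delta> :: "nat \<Rightarrow> ennreal" where "\<delta> \<longlonglongrightarrow> 0"
    "\<And>n x. pts (\<Lambda> \<inter> (\<lambda>a. x + a) ` (K n + C)) / emeasure \<mu> (K n)
        \<le> pts (\<Lambda> \<inter> (\<lambda>a. x + a) ` K n) / emeasure \<mu> (K n) + \<delta> n"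
proof -
  obtain D c where D: "compact D" "D \<noteq> {}" and c: "c < \<infinity>"
    and bd: "\<And>L x. compact L \<Longrightarrow> pts (\<Lambda> \<inter> (\<lambda>a. x + a) ` ((L + C) - L))
        \<le> c * emeasure \<mu> ((L + D) \<inter> ((UNIV - L) + D))"
    by (rule pts_boundary[OF \<Lambda> C Q]) blast
  define \<delta> where "\<delta> n = c * (emeasure \<mu> ((K n + D) \<inter> ((UNIV - K n) + D)) / emeasure \<mu> (K n))" for n
  show ?thesis
  proof (rule that)
    have "\<delta> \<longlonglongrightarrow> c * 0"
      unfolding \<delta>_def
    proof (rule ennreal_tendsto_cmult)
      show "(\<lambda>n. emeasure \<mu> ((K n + D) \<inter> ((UNIV - K n) + D)) / emeasure \<mu> (K n)) \<longlonglongrightarrow> 0"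
        using folner D by (simp add: strong_folner_def)
    qed (use c in simp)
    then show "\<delta> \<longlonglongrightarrow> 0" by simp
    fix n x
    have "pts (\<Lambda> \<inter> (\<lambda>a. x + a) ` (K n + C))
        \<le> pts ((\<Lambda> \<inter> (\<lambda>a. x + a) ` K n) \<union> (\<Lambda> \<inter> (\<lambda>a. x + a) ` ((K n + C) - K n)))"
      by (rule pts_mono) auto
    also have "\<dots> \<le> pts (\<Lambda> \<inter> (\<lambda>a. x + a) ` K n) + pts (\<Lambda> \<inter> (\<lambda>a. x + a) ` ((K n + C) - K n))"
      by (rule pts_Un_le)
    also have "\<dots> \<le> pts (\<Lambda> \<inter> (\<lambda>a. x + a) ` K n) + c * emeasure \<mu> ((K n + D) \<inter> ((UNIV - K n) + D))"
      by (intro add_left_mono bd folner_compact)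
    finally have "pts (\<Lambda> \<inter> (\<lambda>a. x + a) ` (K n + C)) / emeasure \<mu> (K n)
        \<le> (pts (\<Lambda> \<inter> (\<lambda>a. x + a) ` K n) + c * emeasure \<mu> ((K n + D) \<inter> ((UNIV - K n) + D))) / emeasure \<mu> (K n)"
      by (rule divide_right_mono_ennreal)
    also have "\<dots> = pts (\<Lambda> \<inter> (\<lambda>a. x + a) ` K n) / emeasure \<mu> (K n) + \<delta> n"
      by (simp only: add_divide_distrib_ennreal \<delta>_def ennreal_times_divide)
    finally show "pts (\<Lambda> \<inter> (\<lambda>a. x + a) ` (K n + C)) / emeasure \<mu> (K n)
        \<le> pts (\<Lambda> \<inter> (\<lambda>a. x + a) ` K n) / emeasure \<mu> (K n) + \<delta> n" .
  qed
qed

text \<open>\<open>lim\<close> is only meaningful once convergence is known. Averaging translates of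
  \<open>K m\<close> over \<open>K n\<close> compares \<open>u m\<close> with the count in
  \<open>K n + K m\<close>, and the passage from there to \<open>K n\<close> costs only a boundary
  term.\<close>

lemma tendsto_lower_beurling_density:
  fixes \<Lambda> Q :: "'g set"
  assumes \<Lambda>: "relatively_separated \<Lambda>" and Q: "compact_symmetric_nbhd Q"
  shows "(\<lambda>n. INF x. pts (\<Lambda> \<inter> (\<lambda>a. x + a) ` K n) / emeasure \<mu> (K n))
    \<longlonglongrightarrow> lower_beurling_density \<mu> K \<Lambda>"
proof -
  define u where "u n = (INF x. pts (\<Lambda> \<inter> (\<lambda>a. x + a) ` K n) / emeasure \<mu> (K n))" for n
  \<comment> \<open>The enlarging set is \<open>K m\<close>, so each m has its own error sequence in
    n.\<close>
  have "\<exists>\<delta>. \<delta> \<longlonglongrightarrow> 0 \<and> (\<forall>n x. pts (\<Lambda> \<inter> (\<lambda>a. x + a) ` (K n + K m)) / emeasure \<mu> (K n)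
        \<le> pts (\<Lambda> \<inter> (\<lambda>a. x + a) ` K n) / emeasure \<mu> (K n) + \<delta> n)" for m
    by (rule folner_boundary_density[OF \<Lambda> folner_compact[of m] Q]) auto
  then obtain \<delta> where \<delta>: "\<And>m. \<delta> m \<longlonglongrightarrow> 0"
    and bd: "\<And>m n x. pts (\<Lambda> \<inter> (\<lambda>a. x + a) ` (K n + K m)) / emeasure \<mu> (K n)
        \<le> pts (\<Lambda> \<inter> (\<lambda>a. x + a) ` K n) / emeasure \<mu> (K n) + \<delta> m n"
    by metis
  have "u m \<le> u n + \<delta> m n" for m n
  proof -
    have "u m \<le> pts (\<Lambda> \<inter> (\<lambda>a. x + a) ` K n) / emeasure \<mu> (K n) + \<delta> m n" for x
    proof -
      have "u m * emeasure \<mu> (K m) \<le> pts (\<Lambda> \<inter> (\<lambda>a. y + a) ` K m)" for y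
        unfolding u_def by (intro ennreal_mult_leI_divide folner_pos folner_finite INF_lower UNIV_I)
      then have "u m * emeasure \<mu> (K m) * emeasure \<mu> (K n)
          \<le> pts (\<Lambda> \<inter> (\<lambda>a. x + a) ` (K n + K m)) * emeasure \<mu> (K m)"
        by (rule pts_lower_averaging[OF \<Lambda> folner_compact folner_compact])
      then have "u m * emeasure \<mu> (K n) * emeasure \<mu> (K m)
          \<le> pts (\<Lambda> \<inter> (\<lambda>a. x + a) ` (K n + K m)) * emeasure \<mu> (K m)"
        by (simp only: ac_simps)
      then have "u m * emeasure \<mu> (K n) \<le> pts (\<Lambda> \<inter> (\<lambda>a. x + a) ` (K n + K m))"
        by (rule ennreal_mult_right_le_cancel[OF folner_pos folner_finite])
      then have "u m \<le> pts (\<Lambda> \<inter> (\<lambda>a. x + a) ` (K n + K m)) / emeasure \<mu> (K n)"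
        by (rule ennreal_le_divideI[OF folner_pos folner_finite])
      then show ?thesis using bd by (rule order_trans)
    qed
    then show ?thesis unfolding u_def[of n] by (rule ennreal_le_INF_add_const)
  qed
  then have "u \<longlonglongrightarrow> (SUP n. u n)" using \<delta> by (rule tendsto_SUP_if_almost_increasing)
  then have "u \<longlonglongrightarrow> lim u" using limI by metis
  then show ?thesis by (simp only: lower_beurling_density_def u_def[abs_def])
qed

text \<open>Here averaging enlarges the window on the measure side, to \<open>K n - K m\<close>, so
  the first Folner condition is used and the error is a factor tending to 1. Relative separation
  keeps every term finite.\<close>

lemma tendsto_upper_beurling_density:
  fixes \<Lambda> :: "'g set"
  assumes \<Lambda>: "relatively_separated \<Lambda>"
  shows "(\<lambda>n. SUP x. pts (\<Lambda> \<inter> (\<lambda>a. x + a) ` K n) / emeasure \<mu> (K n))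
    \<longlonglongrightarrow> upper_beurling_density \<mu> K \<Lambda>"
proof -
  define u where "u n = (SUP x. pts (\<Lambda> \<inter> (\<lambda>a. x + a) ` K n) / emeasure \<mu> (K n))" for n
  define r where "r m n = 1 + emeasure \<mu> (sym_diff (K n + uminus ` K m) (K n)) / emeasure \<mu> (K n)" for m n
  have "r m \<longlonglongrightarrow> 1 + 0" for m
    unfolding r_def
  proof (intro tendsto_add tendsto_const)
    \<comment> \<open>Nonemptiness is checked because \<open>strong_folner\<close> tests only
      nonempty compact sets.\<close>
    have "compact (uminus ` K m)" "uminus ` K m \<noteq> {}"
      using compact_uminus_group[OF folner_compact] folner_nonempty by auto
    then show "(\<lambda>n. emeasure \<mu> (sym_diff (K n + uminus ` K m) (K n)) / emeasure \<mu> (K n)) \<longlonglongrightarrow> 0"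
      using folner by (simp add: strong_folner_def)
  qed
  then have r: "r m \<longlonglongrightarrow> 1" for m by simp
  have fin: "u m < \<infinity>" for m
  proof -
    obtain N :: nat where N: "\<forall>y. pts (\<Lambda> \<inter> (\<lambda>a. y + a) ` K m) \<le> of_nat N"
      using \<Lambda> folner_compact[of m] unfolding relatively_separated_def by auto
    have "u m \<le> of_nat N / emeasure \<mu> (K m)"
      unfolding u_def by (intro SUP_least divide_right_mono_ennreal N[rule_format])
    also have "\<dots> < \<infinity>"
    proof -
      have "of_nat N / emeasure \<mu> (K m) \<noteq> top"
        using folner_pos[of m] by (auto simp: ennreal_divide_eq_top_iff)
      then show ?thesis by (simp only: infinity_ennreal_def less_top)
    qed
    finally show ?thesis .
  qed
  have "u n \<le> u m * r m n" for m n
    unfolding u_def[of n]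
  proof (rule SUP_least)
    fix x
    have KK: "compact (K n + uminus ` K m)"
      by (intro compact_set_plus compact_uminus_group folner_compact)
    have "pts (\<Lambda> \<inter> (\<lambda>a. y + a) ` K m) \<le> u m * emeasure \<mu> (K m)" for y
    proof -
      have "pts (\<Lambda> \<inter> (\<lambda>a. y + a) ` K m) = pts (\<Lambda> \<inter> (\<lambda>a. y + a) ` K m) * emeasure \<mu> (K m) / emeasure \<mu> (K m)"
        using folner_pos[of m] folner_finite[of m] by (subst mult_divide_eq_ennreal) auto
      also have "\<dots> = pts (\<Lambda> \<inter> (\<lambda>a. y + a) ` K m) / emeasure \<mu> (K m) * emeasure \<mu> (K m)"
        by (simp only: ennreal_times_divide mult.commute)
      also have "\<dots> \<le> u m * emeasure \<mu> (K m)"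
        unfolding u_def by (intro mult_right_mono SUP_upper UNIV_I) simp
      finally show ?thesis .
    qed
    then have "pts (\<Lambda> \<inter> (\<lambda>a. x + a) ` K n) * emeasure \<mu> (K m)
        \<le> u m * emeasure \<mu> (K m) * emeasure \<mu> (K n + uminus ` K m)"
      by (rule pts_upper_averaging[OF \<Lambda> folner_compact folner_compact])
    then have "pts (\<Lambda> \<inter> (\<lambda>a. x + a) ` K n) * emeasure \<mu> (K m)
        \<le> u m * emeasure \<mu> (K n + uminus ` K m) * emeasure \<mu> (K m)"
      by (simp only: ac_simps)
    then have "pts (\<Lambda> \<inter> (\<lambda>a. x + a) ` K n) \<le> u m * emeasure \<mu> (K n + uminus ` K m)"
      by (rule ennreal_mult_right_le_cancel[OF folner_pos folner_finite])
    also have "u m * emeasure \<mu> (K n + uminus ` K m)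
        \<le> u m * (emeasure \<mu> (K n) + emeasure \<mu> (sym_diff (K n + uminus ` K m) (K n)))"
    proof (rule mult_left_mono)
      have m: "K n \<in> sets \<mu>" "K n + uminus ` K m \<in> sets \<mu>"
        using compact_measurable folner_compact KK by auto
      have "emeasure \<mu> (K n + uminus ` K m)
          \<le> emeasure \<mu> (K n \<union> sym_diff (K n + uminus ` K m) (K n))"
        using m by (intro emeasure_mono) auto
      also have "\<dots> \<le> emeasure \<mu> (K n) + emeasure \<mu> (sym_diff (K n + uminus ` K m) (K n))"
        using m by (intro emeasure_subadditive) auto
      finally show "emeasure \<mu> (K n + uminus ` K m)
          \<le> emeasure \<mu> (K n) + emeasure \<mu> (sym_diff (K n + uminus ` K m) (K n))" .
    qed simp
    finally have "pts (\<Lambda> \<inter> (\<lambda>a. x + a) ` K n) / emeasure \<mu> (K n)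
        \<le> u m * (emeasure \<mu> (K n) + emeasure \<mu> (sym_diff (K n + uminus ` K m) (K n))) / emeasure \<mu> (K n)"
      by (rule divide_right_mono_ennreal)
    also have "\<dots> = u m * r m n"
    proof -
      have "emeasure \<mu> (K n) / emeasure \<mu> (K n) = 1"
        using folner_pos[of n] folner_finite[of n] by (intro ennreal_divide_self) auto
      then show ?thesis
        by (simp only: r_def ennreal_times_divide[symmetric] add_divide_distrib_ennreal)
    qed
    finally show "pts (\<Lambda> \<inter> (\<lambda>a. x + a) ` K n) / emeasure \<mu> (K n) \<le> u m * r m n" .
  qed
  then have "u \<longlonglongrightarrow> (INF n. u n)" using r fin by (rule tendsto_INF_if_almost_decreasing)
  then have "u \<longlonglongrightarrow> lim u" using limI by metis
  then show ?thesis by (simp only: upper_beurling_density_def u_def[abs_def])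
qed

end

end

section \<open>Projective representations with a formal degree\<close>

locale formal_degree_rep = unimodular_haar \<mu>
  for \<mu> :: "'g::{topological_group_add, t2_space, second_countable_topology} measure" +
  fixes \<pi> :: "'g \<Rightarrow> 'h \<Rightarrow> 'h::complex_hilbert_space" and d :: real
  assumes proj_rep: "projective_unitary_rep \<pi>"
    and degree: "formal_degree \<mu> \<pi> d"
begin

lemma degree_pos: "d > 0"
  using degree by (simp add: formal_degree_def)

lemma cinner_rep [simp]: "cinner (\<pi> x f) (\<pi> x h) = cinner f h"
  using proj_rep by (simp add: projective_unitary_rep_def unitary_def)

lemma norm_rep [simp]: "norm (\<pi> x f) = norm f"
proof -
  have "complex_of_real ((norm (\<pi> x f))\<^sup>2) = complex_of_real ((norm f)\<^sup>2)"
    by (simp only: cinner_self[symmetric] cinner_rep)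
  then have "(norm (\<pi> x f))\<^sup>2 = (norm f)\<^sup>2" by (simp only: of_real_eq_iff)
  then show ?thesis by (simp add: power2_eq_iff_nonneg)
qed

text \<open>The cocycle has modulus 1 and drops out, so only the difference \<open>- x + y\<close>
  matters.\<close>

lemma cmod_cinner_rep_rep: "cmod (cinner (\<pi> x f) (\<pi> y h)) = cmod (cinner f (\<pi> (- x + y) h))"
proof -
  obtain \<sigma> :: "'g \<Rightarrow> 'g \<Rightarrow> complex" where
    \<sigma>: "\<And>x y. cmod (\<sigma> x y) = 1" "\<And>x y f. \<pi> (x + y) f = \<sigma> x y *\<^sub>C \<pi> x (\<pi> y f)"
    using proj_rep unfolding projective_unitary_rep_def by metis
  have "\<pi> y h = \<pi> (x + (- x + y)) h" by (simp flip: add.assoc)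
  also have "\<dots> = \<sigma> x (- x + y) *\<^sub>C \<pi> x (\<pi> (- x + y) h)" by (rule \<sigma>(2))
  finally show ?thesis by (simp add: cinner_scaleC_right norm_mult \<sigma>(1))
qed

lemma measurable_cinner_rep [measurable]: "(\<lambda>x. cinner f (\<pi> x h)) \<in> borel_measurable borel"
  by (rule borel_measurable_continuous_on[OF linear_continuous_on[OF bounded_linear_cinner_right]])
     (use proj_rep in \<open>simp add: projective_unitary_rep_def\<close>)

text \<open>The diagonal case of the formal degree identity, as a nonnegative integral.\<close>

lemma orthogonality_relation:
  "(\<integral>\<^sup>+x. ennreal ((cmod (cinner f (\<pi> x h)))\<^sup>2) \<partial>\<mu>) = ennreal ((norm f)\<^sup>2 * (norm h)\<^sup>2 / d)"
proof -
  have "has_bochner_integral \<mu> (\<lambda>x. cinner f (\<pi> x h) * cinner (\<pi> x h) f)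
      (inverse (complex_of_real d) * cinner f f * cnj (cinner h h))"
    using degree by (simp only: formal_degree_def)
  moreover have "cinner f (\<pi> x h) * cinner (\<pi> x h) f = complex_of_real ((cmod (cinner f (\<pi> x h)))\<^sup>2)" for x
    by (simp only: complex_norm_square cinner_commute[of "\<pi> x h" f])
  moreover have "inverse (complex_of_real d) * cinner f f * cnj (cinner h h)
      = complex_of_real ((norm f)\<^sup>2 * (norm h)\<^sup>2 / d)"
    by (simp add: cinner_self field_simps)
  ultimately have "has_bochner_integral \<mu> (\<lambda>x. complex_of_real ((cmod (cinner f (\<pi> x h)))\<^sup>2))
      (complex_of_real ((norm f)\<^sup>2 * (norm h)\<^sup>2 / d))"
    by (simp only:)
  from has_bochner_integral_Re[OF this]
  have h: "has_bochner_integral \<mu> (\<lambda>x. (cmod (cinner f (\<pi> x h)))\<^sup>2) ((norm f)\<^sup>2 * (norm h)\<^sup>2 / d)"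
    by (simp only: Re_complex_of_real)
  then show ?thesis
    by (subst nn_integral_eq_integral)
       (auto simp: has_bochner_integral_iff)
qed

definition profile :: "'h \<Rightarrow> 'g \<Rightarrow> ennreal" where
  "profile g z = ennreal ((cmod (matrix_coeff \<pi> g g z))\<^sup>2)"

lemma measurable_profile [measurable]: "profile g \<in> borel_measurable borel"
  unfolding profile_def matrix_coeff_def by measurable

text \<open>The squared frame coefficients of all vectors \<open>\<pi> x g\<close> are samples of
  one function on the group, so their tails can be cut off uniformly in x.\<close>

lemma profile_reflect: "profile g (- x + l) = ennreal ((cmod (cinner (\<pi> x g) (\<pi> l g)))\<^sup>2)"
  by (simp add: profile_def matrix_coeff_def cmod_cinner_rep_rep)

lemma nn_integral_profile: "(\<integral>\<^sup>+z. profile g z \<partial>\<mu>) = ennreal ((norm g)\<^sup>2 * (norm g)\<^sup>2 / d)"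
  unfolding profile_def matrix_coeff_def by (rule orthogonality_relation)

text \<open>Integrate the Bessel inequality for \<open>f = \<pi> x g\<close> over \<open>x \<in> y + C - D\<close>, where \<open>D\<close> carries mass of the profile.\<close>

lemma relatively_separated_if_frame:
  fixes \<Lambda> :: "'g set"
  assumes fr: "hilbert_frame \<Lambda> (\<lambda>l. \<pi> l g) A B" and g: "g \<noteq> 0"
  shows "relatively_separated \<Lambda>"
  unfolding relatively_separated_def
proof (intro allI impI)
  interpret fr: hilbert_frame \<Lambda> "\<lambda>l. \<pi> l g" A B by (rule fr)
  fix C :: "'g set" assume C: "compact C"
  define I where "I = (\<integral>\<^sup>+z. profile g z \<partial>\<mu>)"
  have Ipos: "0 < I" using g degree_pos by (simp add: I_def nn_integral_profile)
  have Ifin: "I < \<infinity>" by (simp add: I_def nn_integral_profile)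
  \<comment> \<open>A tail strictly below the total mass I forces the mass c on D to be positive, so
    that one can divide by c.\<close>
  obtain D :: "'g set" where D: "compact D" "(\<integral>\<^sup>+z. profile g z * indicator (- D) z \<partial>\<mu>) < I"
    using small_tail[OF measurable_profile Ifin[unfolded I_def] Ipos] by metis
  have [measurable]: "D \<in> sets borel" using compact_measurable[OF D(1)] by simp
  define c where "c = (\<integral>\<^sup>+z. profile g z * indicator D z \<partial>\<mu>)"
  have "I = (\<integral>\<^sup>+z. profile g z * indicator D z + profile g z * indicator (- D) z \<partial>\<mu>)"
    unfolding I_def by (intro nn_integral_cong) (auto split: split_indicator)
  also have "\<dots> = c + (\<integral>\<^sup>+z. profile g z * indicator (- D) z \<partial>\<mu>)"
    unfolding c_def by (rule nn_integral_add) measurable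
  finally have Ic: "I = c + (\<integral>\<^sup>+z. profile g z * indicator (- D) z \<partial>\<mu>)" .
  have cpos: "0 < c"
  proof (rule ccontr)
    assume "\<not> 0 < c"
    then have "c = 0" by simp
    then show False using Ic D(2) by simp
  qed
  have cfin: "c < \<infinity>"
  proof -
    have "c \<le> I" unfolding Ic by simp
    then show ?thesis using Ifin by (rule order_le_less_trans)
  qed
  define X where "X = C + uminus ` D"
  have X: "compact X" unfolding X_def by (intro compact_set_plus compact_uminus_group C D)
  define M where "M = ennreal (B * (norm g)\<^sup>2) * emeasure \<mu> X"
  have Mfin: "M < \<infinity>" using finite_compact[OF X] by (simp add: M_def ennreal_mult_less_top)
  \<comment> \<open>Each l in S contributes exactly c to the integral, while for each x the Bessel
    bound caps the sum over S. Finite S are used because the whole intersection is not yet known to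
    be finite.\<close>
  have key: "of_nat (card S) * c \<le> M" if S: "finite S" "S \<subseteq> \<Lambda> \<inter> (\<lambda>a. y + a) ` C" for S y
  proof -
    have [measurable]: "(\<lambda>a. y + a) ` X \<in> sets borel"
      using compact_measurable[OF compact_translation_group[OF X]] by simp
    have "of_nat (card S) * c = (\<Sum>l\<in>S. c)" by simp
    also have "\<dots> = (\<Sum>l\<in>S. \<integral>\<^sup>+x. profile g (- x + l) * indicator D (- x + l) \<partial>\<mu>)"
      unfolding c_def by (intro sum.cong refl nn_integral_reflect[symmetric]) measurable
    also have "\<dots> = (\<integral>\<^sup>+x. (\<Sum>l\<in>S. profile g (- x + l) * indicator D (- x + l)) \<partial>\<mu>)"
      by (rule nn_integral_sum[symmetric]) measurable
    also have "\<dots> \<le> (\<integral>\<^sup>+x. ennreal (B * (norm g)\<^sup>2) * indicator ((\<lambda>a. y + a) ` X) x \<partial>\<mu>)"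
    proof (rule nn_integral_mono)
      fix x
      show "(\<Sum>l\<in>S. profile g (- x + l) * indicator D (- x + l))
          \<le> ennreal (B * (norm g)\<^sup>2) * indicator ((\<lambda>a. y + a) ` X) x"
      proof (cases "x \<in> (\<lambda>a. y + a) ` X")
        case True
        have "(\<Sum>l\<in>S. profile g (- x + l) * indicator D (- x + l)) \<le> (\<Sum>l\<in>S. profile g (- x + l))"
          by (intro sum_mono) (auto split: split_indicator)
        also have "\<dots> = ennreal (\<Sum>l\<in>S. (cmod (cinner (\<pi> x g) (\<pi> l g)))\<^sup>2)"
          unfolding profile_reflect by (rule sum_ennreal) simp
        also have "\<dots> \<le> ennreal (B * (norm g)\<^sup>2)"
        proof (rule ennreal_leI)
          have "(\<Sum>l\<in>S. (cmod (cinner (\<pi> x g) (\<pi> l g)))\<^sup>2)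
              \<le> (\<Sum>\<^sub>\<infinity>l\<in>\<Lambda>. (cmod (cinner (\<pi> x g) (\<pi> l g)))\<^sup>2)"
            using S by (intro finite_sum_le_infsum fr.coeff_summable) auto
          also have "\<dots> \<le> B * (norm (\<pi> x g))\<^sup>2" by (rule fr.upper_bound)
          finally show "(\<Sum>l\<in>S. (cmod (cinner (\<pi> x g) (\<pi> l g)))\<^sup>2) \<le> B * (norm g)\<^sup>2" by simp
        qed
        finally show ?thesis using True by simp
      next
        case False
        have "indicator D (- x + l) = (0::ennreal)" if l: "l \<in> S" for l
        proof (rule ccontr)
          assume "indicator D (- x + l) \<noteq> (0::ennreal)"
          then have "- x + l \<in> D" by (auto split: split_indicator_asm)
          moreover have "- y + l \<in> C" using l S(2) by (auto simp flip: mem_translate_iff)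
          ultimately have "(- y + l) + - (- x + l) \<in> X" unfolding X_def by (intro set_plus_intro) auto
          then have "- y + x \<in> X" by (simp add: minus_add add.assoc)
          then show False using False by (simp add: mem_translate_iff)
        qed
        then show ?thesis by simp
      qed
    qed
    also have "\<dots> = M"
      unfolding M_def using compact_measurable[OF X]
      by (subst nn_integral_cmult_indicator) (auto simp: emeasure_left)
    finally show ?thesis .
  qed
  have "M / c < top"
    using cpos Mfin by (auto simp: less_top[symmetric] ennreal_divide_eq_top_iff)
  then obtain N :: nat where N: "M / c < of_nat N" using ennreal_Ex_less_of_nat by blast
  have card_le: "card S \<le> N" if S: "finite S" "S \<subseteq> \<Lambda> \<inter> (\<lambda>a. y + a) ` C" for S y
  proof -
    have "(of_nat (card S) :: ennreal) \<le> M / c"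
      by (rule ennreal_le_divideI[OF cpos cfin key[OF S]])
    then have "(of_nat (card S) :: ennreal) < of_nat N" using N by (rule order_le_less_trans)
    then show ?thesis by (simp only: of_nat_less_iff less_imp_le)
  qed
  have "pts (\<Lambda> \<inter> (\<lambda>a. y + a) ` C) \<le> of_nat N" for y
  proof (cases "finite (\<Lambda> \<inter> (\<lambda>a. y + a) ` C)")
    case True
    then show ?thesis using card_le[OF True order_refl] by (subst emeasure_count_space) auto
  next
    case False
    then obtain S where "finite S" "card S = Suc N" "S \<subseteq> \<Lambda> \<inter> (\<lambda>a. y + a) ` C"
      using infinite_arbitrarily_large by metis
    then show ?thesis using card_le[of S y] by simp
  qed
  then show "\<exists>N::nat. \<forall>y. pts (\<Lambda> \<inter> (\<lambda>a. y + a) ` C) \<le> of_nat N" by auto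
qed

end

text \<open>For each w the maximal function dominates the coefficient at almost every z in
  \<open>w + Q\<close>, with an exceptional set depending on w. Averaging over all w with z in
  \<open>w + Q\<close>, a set of measure \<open>\<mu> Q\<close>, gives a bound at almost every
  z.\<close>

lemma (in formal_degree_rep) profile_le_left_maximal_average:
  fixes Q :: "'g set"
  assumes Q: "compact_symmetric_nbhd Q" and g: "g \<in> localized_vectors \<mu> Q \<pi>"
  shows "AE z in \<mu>. profile g z * emeasure \<mu> Q
    \<le> (\<integral>\<^sup>+w. (left_maximal \<mu> Q (matrix_coeff \<pi> g g) w)\<^sup>2 * indicator Q (- w + z) \<partial>\<mu>)"
proof -
  let ?F = "matrix_coeff \<pi> g g"
  let ?M = "left_maximal \<mu> Q (matrix_coeff \<pi> g g)"
  have cQ: "compact Q" using Q by (simp add: compact_symmetric_nbhd_def)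
  have [measurable]: "Q \<in> sets borel" using compact_measurable[OF cQ] by simp
  have M [measurable]: "?M \<in> borel_measurable borel"
    using g by (simp add: localized_vectors_def wiener_L2_def measurable_cong_sets[OF sets_mu refl])
  have F [measurable]: "?F \<in> borel_measurable borel"
    unfolding matrix_coeff_def by measurable
  have "AE z in \<mu>. - w + z \<in> Q \<longrightarrow> ennreal (cmod (?F z)) \<le> ?M w" for w
  proof -
    have "AE q in restrict_space \<mu> Q. ennreal (cmod (?F (w + q))) \<le> ?M w"
      unfolding left_maximal_def by (rule esssup_AE)
    then have "AE q in \<mu>. q \<in> Q \<longrightarrow> ennreal (cmod (?F (w + q))) \<le> ?M w"
      by (subst (asm) AE_restrict_space_iff) auto
    then have "AE z in \<mu>. - w + z \<in> Q \<longrightarrow> ennreal (cmod (?F (w + (- w + z)))) \<le> ?M w"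
      by (rule AE_left)
    then show ?thesis by (simp flip: add.assoc)
  qed
  then have "AE w in \<mu>. AE z in \<mu>. - w + z \<in> Q \<longrightarrow> ennreal (cmod (?F z)) \<le> ?M w"
    by simp
  \<comment> \<open>Fubini for null sets exchanges the two quantifiers, so that z can be fixed and w
    integrated.\<close>
  then have "AE z in \<mu>. AE w in \<mu>. - w + z \<in> Q \<longrightarrow> ennreal (cmod (?F z)) \<le> ?M w"
    by (subst mu2.AE_commute[symmetric]) measurable
  then show ?thesis
  proof (rule AE_mp[OF _ AE_I2, rule_format])
    fix z
    assume z: "AE w in \<mu>. - w + z \<in> Q \<longrightarrow> ennreal (cmod (?F z)) \<le> ?M w"
    have "profile g z * emeasure \<mu> Q = profile g z * (\<integral>\<^sup>+w. indicator Q (- w + z) \<partial>\<mu>)"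
      by (simp only: nn_integral_reflect_indicator[OF cQ])
    also have "\<dots> = (\<integral>\<^sup>+w. profile g z * indicator Q (- w + z) \<partial>\<mu>)"
      by (rule nn_integral_cmult[symmetric]) measurable
    also have "\<dots> \<le> (\<integral>\<^sup>+w. (?M w)\<^sup>2 * indicator Q (- w + z) \<partial>\<mu>)"
    proof (rule nn_integral_mono_AE, use z in eventually_elim)
      case (elim w)
      show ?case
      proof (cases "- w + z \<in> Q")
        case True
        then have "(ennreal (cmod (?F z)))\<^sup>2 \<le> (?M w)\<^sup>2"
          using elim by (intro power_mono) auto
        then show ?thesis using True by (simp add: profile_def ennreal_power)
      qed simp
    qed
    finally show "profile g z * emeasure \<mu> Q
        \<le> (\<integral>\<^sup>+w. (?M w)\<^sup>2 * indicator Q (- w + z) \<partial>\<mu>)" .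
  qed
qed

text \<open>
  The sets \<open>l + Q\<close> overlap boundedly often, so the averages in the previous bound sum up to at most
  a multiple of the integral of the squared maximal function outside a compact set.
\<close>

lemma (in formal_degree_rep) small_profile_tail_sum:
  fixes \<Lambda> Q :: "'g set"
  assumes Q: "compact_symmetric_nbhd Q" and g: "g \<in> localized_vectors \<mu> Q \<pi>"
    and \<Lambda>: "relatively_separated \<Lambda>" and e: "0 < e"
  obtains C where "compact C"
    "AE x in \<mu>. (\<integral>\<^sup>+l. indicator (- C) (- x + l) * profile g (- x + l) \<partial>count_space \<Lambda>) \<le> e"
proof -
  let ?M = "left_maximal \<mu> Q (matrix_coeff \<pi> g g)"
  have cQ: "compact Q" and Q0: "0 \<in> interior Q" and sQ: "uminus ` Q = Q"
    using Q by (simp_all add: compact_symmetric_nbhd_def)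
  have Qm [measurable]: "Q \<in> sets borel" using compact_measurable[OF cQ] by simp
  have M [measurable]: "?M \<in> borel_measurable borel"
    using g by (simp add: localized_vectors_def wiener_L2_def measurable_cong_sets[OF sets_mu refl])
  have Mfin: "(\<integral>\<^sup>+w. (?M w)\<^sup>2 \<partial>\<mu>) < \<infinity>"
    using g by (simp add: localized_vectors_def wiener_L2_def measurable_cong_sets[OF sets_mu refl])
  have Qpos: "emeasure \<mu> Q > 0"
  proof -
    have "0 < emeasure \<mu> (interior Q)" using Q0 by (intro emeasure_open_pos) auto
    also have "\<dots> \<le> emeasure \<mu> Q" by (intro emeasure_mono interior_subset) simp
    finally show ?thesis .
  qed
  have Qfin: "emeasure \<mu> Q < \<infinity>" by (rule finite_compact[OF cQ])
  obtain N :: nat where N: "\<forall>y. pts (\<Lambda> \<inter> (\<lambda>a. y + a) ` Q) \<le> of_nat N"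
    using \<Lambda> cQ unfolding relatively_separated_def by auto
  \<comment> \<open>At most N points fall into a translate of Q, and the final bound is divided by
    \<open>\<mu> Q\<close>. \<open>Suc N\<close> avoids division by 0 when N = 0.\<close>
  define \<eta> where "\<eta> = e * emeasure \<mu> Q / of_nat (Suc N)"
  have \<eta>: "0 < \<eta>" using e Qpos by (simp add: \<eta>_def ennreal_zero_less_divide ennreal_zero_less_mult_iff of_nat_less_top)
  have N\<eta>: "of_nat N * \<eta> \<le> e * emeasure \<mu> Q"
  proof -
    have "of_nat N * \<eta> \<le> of_nat (Suc N) * \<eta>" by (intro mult_right_mono) auto
    also have "\<dots> = e * emeasure \<mu> Q * of_nat (Suc N) / of_nat (Suc N)"
      by (simp only: \<eta>_def ennreal_times_divide mult.commute)
    also have "\<dots> = e * emeasure \<mu> Q" by (rule mult_divide_eq_ennreal) (simp_all del: of_nat_Suc)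
    finally show ?thesis .
  qed
  obtain C0 :: "'g set" where C0: "compact C0"
    and tail: "(\<integral>\<^sup>+w. (?M w)\<^sup>2 * indicator (- C0) w \<partial>\<mu>) < \<eta>"
    by (rule small_tail[OF _ Mfin \<eta>]) measurable
  have [measurable]: "C0 \<in> sets borel" using compact_measurable[OF C0] by simp
  \<comment> \<open>If \<open>- x + l\<close> is outside C but within \<open>w + Q\<close>, then w
    is outside C0.\<close>
  define C where "C = C0 + Q"
  have C: "compact C" unfolding C_def by (intro compact_set_plus C0 cQ)
  \<comment> \<open>For each l the exceptional z are carried to exceptional x by
    \<open>z = - x + l\<close>; countability unites these null sets.\<close>
  have "AE x in \<mu>. \<forall>l\<in>\<Lambda>. profile g (- x + l) * emeasure \<mu> Q
      \<le> (\<integral>\<^sup>+w. (?M w)\<^sup>2 * indicator Q (- w + (- x + l)) \<partial>\<mu>)"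
    by (intro AE_ball_countable' AE_reflect[OF profile_le_left_maximal_average[OF Q g]]
        relatively_separated_countable \<Lambda>)
  then have "AE x in \<mu>. (\<integral>\<^sup>+l. indicator (- C) (- x + l) * profile g (- x + l) \<partial>count_space \<Lambda>) \<le> e"
  proof (rule AE_mp[OF _ AE_I2, rule_format])
    fix x
    assume pw: "\<forall>l\<in>\<Lambda>. profile g (- x + l) * emeasure \<mu> Q
      \<le> (\<integral>\<^sup>+w. (?M w)\<^sup>2 * indicator Q (- w + (- x + l)) \<partial>\<mu>)"
    have "(\<integral>\<^sup>+l. indicator (- C) (- x + l) * profile g (- x + l) \<partial>count_space \<Lambda>) * emeasure \<mu> Q
        = (\<integral>\<^sup>+l. indicator (- C) (- x + l) * profile g (- x + l) * emeasure \<mu> Q \<partial>count_space \<Lambda>)"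
      by (rule nn_integral_multc[symmetric]) simp
    also have "\<dots> \<le> (\<integral>\<^sup>+l. \<integral>\<^sup>+w. indicator (- C) (- x + l)
        * ((?M w)\<^sup>2 * indicator Q (- w + (- x + l))) \<partial>\<mu> \<partial>count_space \<Lambda>)"
    proof (rule nn_integral_mono)
      fix l assume "l \<in> space (count_space \<Lambda>)"
      then have "profile g (- x + l) * emeasure \<mu> Q
          \<le> (\<integral>\<^sup>+w. (?M w)\<^sup>2 * indicator Q (- w + (- x + l)) \<partial>\<mu>)" using pw by simp
      then have "indicator (- C) (- x + l) * (profile g (- x + l) * emeasure \<mu> Q)
          \<le> indicator (- C) (- x + l) * (\<integral>\<^sup>+w. (?M w)\<^sup>2 * indicator Q (- w + (- x + l)) \<partial>\<mu>)"
        by (rule mult_left_mono) simp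
      also have "\<dots> = (\<integral>\<^sup>+w. indicator (- C) (- x + l) * ((?M w)\<^sup>2 * indicator Q (- w + (- x + l))) \<partial>\<mu>)"
        by (rule nn_integral_cmult[symmetric]) measurable
      finally show "indicator (- C) (- x + l) * profile g (- x + l) * emeasure \<mu> Q
          \<le> (\<integral>\<^sup>+w. indicator (- C) (- x + l) * ((?M w)\<^sup>2 * indicator Q (- w + (- x + l))) \<partial>\<mu>)"
        by (simp only: mult.assoc)
    qed
    also have "\<dots> = (\<integral>\<^sup>+w. \<integral>\<^sup>+l. indicator (- C) (- x + l)
        * ((?M w)\<^sup>2 * indicator Q (- w + (- x + l))) \<partial>count_space \<Lambda> \<partial>\<mu>)"
      by (intro nn_integral_count_swap[symmetric] \<Lambda>) measurable
    also have "\<dots> \<le> (\<integral>\<^sup>+w. of_nat N * ((?M w)\<^sup>2 * indicator (- C0) w) \<partial>\<mu>)"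
    proof (rule nn_integral_mono)
      fix w
      show "(\<integral>\<^sup>+l. indicator (- C) (- x + l) * ((?M w)\<^sup>2 * indicator Q (- w + (- x + l))) \<partial>count_space \<Lambda>)
          \<le> of_nat N * ((?M w)\<^sup>2 * indicator (- C0) w)"
      proof (cases "w \<in> C0")
        case True
        have eq: "indicator (- C) (- x + l) * ((?M w)\<^sup>2 * indicator Q (- w + (- x + l))) = 0" for l
        proof (cases "- w + (- x + l) \<in> Q")
          case q: True
          have "w + (- w + (- x + l)) \<in> C" unfolding C_def using True q by (rule set_plus_intro)
          then have "- x + l \<in> C" by (simp only: add_minus_cancel)
          then show ?thesis by simp
        qed simp
        show ?thesis unfolding eq by simp
      next
        case False
        have mem: "l \<in> (\<lambda>a. x + w + a) ` Q \<longleftrightarrow> - w + (- x + l) \<in> Q" for l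
          unfolding mem_translate_iff by (simp only: minus_add add.assoc)
        have "(\<integral>\<^sup>+l. indicator (- C) (- x + l) * ((?M w)\<^sup>2 * indicator Q (- w + (- x + l))) \<partial>count_space \<Lambda>)
            \<le> (\<integral>\<^sup>+l. (?M w)\<^sup>2 * indicator ((\<lambda>a. x + w + a) ` Q) l \<partial>count_space \<Lambda>)"
          by (intro nn_integral_mono) (auto simp: mem split: split_indicator)
        also have "\<dots> = (?M w)\<^sup>2 * pts (\<Lambda> \<inter> (\<lambda>a. x + w + a) ` Q)"
          unfolding pts_Int_eq_nn_integral by (rule nn_integral_cmult) simp
        also have "\<dots> \<le> (?M w)\<^sup>2 * of_nat N"
          by (intro mult_left_mono N[rule_format]) simp
        finally show ?thesis using False by (simp add: mult.commute)
      qed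
    qed
    also have "\<dots> = of_nat N * (\<integral>\<^sup>+w. (?M w)\<^sup>2 * indicator (- C0) w \<partial>\<mu>)"
      by (rule nn_integral_cmult) measurable
    also have "\<dots> \<le> of_nat N * \<eta>"
      using tail by (intro mult_left_mono) auto
    also have "\<dots> \<le> e * emeasure \<mu> Q" by (rule N\<eta>)
    finally show "(\<integral>\<^sup>+l. indicator (- C) (- x + l) * profile g (- x + l) \<partial>count_space \<Lambda>) \<le> e"
      by (rule ennreal_mult_right_le_cancel[OF Qpos Qfin])
  qed
  with C show ?thesis by (rule that)
qed

section \<open>Counting frame elements\<close>

text \<open>
  Apply the finite approximation of the frame to the vectors \<open>\<pi> x g\<close> with \<open>x \<in> K\<close> and integrate
  over \<open>K\<close>: by orthogonality, each of the orthonormal vectors contributes at most \<open>(norm g)\<^sup>2 / d\<close>.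
\<close>

lemma (in formal_degree_rep) frame_pts_lower_bound:
  fixes \<Lambda> Q :: "'g set"
  assumes fr: "hilbert_frame \<Lambda> (\<lambda>l. \<pi> l g) A B" and g0: "g \<noteq> 0"
    and Q: "compact_symmetric_nbhd Q" and g: "g \<in> localized_vectors \<mu> Q \<pi>" and e: "0 < e"
  obtains C where "compact C"
    "\<And>K. compact K \<Longrightarrow> ennreal (d * (1 - e)) * emeasure \<mu> K \<le> pts (\<Lambda> \<inter> (K + C))"
proof -
  interpret fr: hilbert_frame \<Lambda> "\<lambda>l. \<pi> l g" A B by (rule fr)
  have sep: "relatively_separated \<Lambda>" by (rule relatively_separated_if_frame[OF fr g0])
  \<comment> \<open>The finite approximation divides the tail by A, which leaves the error
    \<open>e * (norm g)\<^sup>2\<close>.\<close>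
  define t where "t = e * A * (norm g)\<^sup>2"
  have t: "0 < t" using e fr.lower_pos g0 by (simp add: t_def)
  obtain C where C: "compact C"
    and tail: "AE x in \<mu>. (\<integral>\<^sup>+l. indicator (- C) (- x + l) * profile g (- x + l) \<partial>count_space \<Lambda>) \<le> ennreal t"
    using small_profile_tail_sum[OF Q g sep, of "ennreal t"] t by auto
  show ?thesis
  proof (rule that[OF C])
    fix K :: "'g set" assume K: "compact K"
    have [measurable]: "K \<in> sets borel" using compact_measurable[OF K] by simp
    define S where "S = \<Lambda> \<inter> (K + C)"
    obtain N :: nat where "\<forall>y. pts (\<Lambda> \<inter> (\<lambda>a. y + a) ` (K + C)) \<le> of_nat N"
      using sep compact_set_plus[OF K C] unfolding relatively_separated_def by auto
    then have "pts (\<Lambda> \<inter> (\<lambda>a. 0 + a) ` (K + C)) \<le> of_nat N" by (rule spec)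
    then have "finite (\<Lambda> \<inter> (\<lambda>a. 0 + a) ` (K + C))" by (rule pts_le_of_natD)
    then have S: "finite S" by (simp add: S_def)
    obtain E where E: "finite E" "card E \<le> card S" "orthonormal E"
      and approx: "\<And>f. A * ((norm f)\<^sup>2 - (\<Sum>e\<in>E. (cmod (cinner f e))\<^sup>2))
        \<le> (\<Sum>\<^sub>\<infinity>l\<in>\<Lambda> - S. (cmod (cinner f (\<pi> l g)))\<^sup>2)"
      using fr.finite_approximation[OF S] by (metis S_def inf_le1)
    \<comment> \<open>On the right the bound variable e ranges over E and shadows the tolerance e of
      the left side.\<close>
    have pw: "(norm g)\<^sup>2 * (1 - e) \<le> (\<Sum>e\<in>E. (cmod (cinner e (\<pi> x g)))\<^sup>2)"
      if x: "x \<in> K" and tx: "(\<integral>\<^sup>+l. indicator (- C) (- x + l) * profile g (- x + l) \<partial>count_space \<Lambda>) \<le> ennreal t"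
      for x
    proof -
      have "(\<Sum>\<^sub>\<infinity>l\<in>\<Lambda> - S. (cmod (cinner (\<pi> x g) (\<pi> l g)))\<^sup>2) \<le> t"
      proof (rule infsum_le_finite_sums)
        show "(\<lambda>l. (cmod (cinner (\<pi> x g) (\<pi> l g)))\<^sup>2) summable_on \<Lambda> - S"
          by (rule summable_on_subset[OF fr.coeff_summable]) auto
        fix T assume T: "finite T" "T \<subseteq> \<Lambda> - S"
        let ?h = "\<lambda>l. indicator (- C) (- x + l) * profile g (- x + l)"
        have out: "- x + l \<in> - C" if "l \<in> T" for l
        proof
          assume "- x + l \<in> C"
          then have "x + (- x + l) \<in> K + C" by (intro set_plus_intro x)
          then have "l \<in> K + C" by (simp flip: add.assoc)
          then show False using that T(2) by (auto simp: S_def)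
        qed
        have "ennreal (\<Sum>l\<in>T. (cmod (cinner (\<pi> x g) (\<pi> l g)))\<^sup>2) = (\<Sum>l\<in>T. profile g (- x + l))"
          unfolding profile_reflect by (rule sum_ennreal[symmetric]) simp
        also have "\<dots> = (\<Sum>l\<in>T. ?h l * indicator T l)"
          by (intro sum.cong refl) (use out in simp)
        also have "\<dots> = (\<integral>\<^sup>+l. ?h l * indicator T l \<partial>count_space \<Lambda>)"
          by (rule nn_integral_count_space'[symmetric]) (use T in auto)
        also have "\<dots> \<le> (\<integral>\<^sup>+l. ?h l \<partial>count_space \<Lambda>)"
          by (intro nn_integral_mono) (auto split: split_indicator)
        also have "\<dots> \<le> ennreal t" by (rule tx)
        finally show "(\<Sum>l\<in>T. (cmod (cinner (\<pi> x g) (\<pi> l g)))\<^sup>2) \<le> t"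
          using t by (subst (asm) ennreal_le_iff) auto
      qed
      then have "A * ((norm g)\<^sup>2 - (\<Sum>e\<in>E. (cmod (cinner (\<pi> x g) e))\<^sup>2)) \<le> A * (e * (norm g)\<^sup>2)"
        using approx[of "\<pi> x g"] by (simp add: t_def ac_simps)
      then have "(norm g)\<^sup>2 - (\<Sum>e\<in>E. (cmod (cinner (\<pi> x g) e))\<^sup>2) \<le> e * (norm g)\<^sup>2"
        using fr.lower_pos by (simp only: mult_le_cancel_left_pos)
      moreover have "cmod (cinner (\<pi> x g) e') = cmod (cinner e' (\<pi> x g))" for e'
        by (subst cinner_commute) simp
      ultimately show ?thesis by (simp add: algebra_simps)
    qed
    have "ennreal ((norm g)\<^sup>2 * (1 - e)) * emeasure \<mu> K
        = (\<integral>\<^sup>+x. ennreal ((norm g)\<^sup>2 * (1 - e)) * indicator K x \<partial>\<mu>)"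
      by (subst nn_integral_cmult_indicator) auto
    also have "\<dots> \<le> (\<integral>\<^sup>+x. (\<Sum>e\<in>E. ennreal ((cmod (cinner e (\<pi> x g)))\<^sup>2)) \<partial>\<mu>)"
    proof (rule nn_integral_mono_AE, use tail in eventually_elim)
      case (elim x)
      show ?case
      proof (cases "x \<in> K")
        case True
        have "ennreal ((norm g)\<^sup>2 * (1 - e)) \<le> ennreal (\<Sum>e\<in>E. (cmod (cinner e (\<pi> x g)))\<^sup>2)"
          by (rule ennreal_leI[OF pw[OF True elim]])
        also have "\<dots> = (\<Sum>e\<in>E. ennreal ((cmod (cinner e (\<pi> x g)))\<^sup>2))"
          by (rule sum_ennreal[symmetric]) simp
        finally show ?thesis using True by simp
      qed simp
    qed
    also have "\<dots> = (\<Sum>e\<in>E. \<integral>\<^sup>+x. ennreal ((cmod (cinner e (\<pi> x g)))\<^sup>2) \<partial>\<mu>)"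
      by (rule nn_integral_sum) measurable
    also have "\<dots> = (\<Sum>e\<in>E. ennreal ((norm g)\<^sup>2 / d))"
      by (intro sum.cong refl) (simp add: orthogonality_relation orthonormal_norm[OF E(3)])
    also have "\<dots> \<le> of_nat (card S) * ennreal ((norm g)\<^sup>2 / d)"
      using E(2) by (simp add: mult_right_mono)
    finally have le: "ennreal ((norm g)\<^sup>2 * (1 - e)) * emeasure \<mu> K
        \<le> of_nat (card S) * ennreal ((norm g)\<^sup>2 / d)" .
    \<comment> \<open>The inverse of the mass that each unit vector of E contributes.\<close>
    let ?c = "d / (norm g)\<^sup>2"
    have c: "0 < ?c" using degree_pos g0 by simp
    have "ennreal (d * (1 - e)) * emeasure \<mu> K
        = ennreal ?c * (ennreal ((norm g)\<^sup>2 * (1 - e)) * emeasure \<mu> K)"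
    proof -
      have "d * (1 - e) = ?c * ((norm g)\<^sup>2 * (1 - e))" using g0 by simp
      then show ?thesis using c by (simp only: ennreal_mult'[OF less_imp_le[OF c]] mult.assoc)
    qed
    also have "\<dots> \<le> ennreal ?c * (of_nat (card S) * ennreal ((norm g)\<^sup>2 / d))"
      by (intro mult_left_mono le) simp
    also have "\<dots> = of_nat (card S) * (ennreal ?c * ennreal ((norm g)\<^sup>2 / d))"
      by (simp only: ac_simps)
    also have "ennreal ?c * ennreal ((norm g)\<^sup>2 / d) = 1"
      using c degree_pos g0 by (simp flip: ennreal_mult')
    also have "of_nat (card S) * 1 = pts S"
      using S by simp
    finally show "ennreal (d * (1 - e)) * emeasure \<mu> K \<le> pts (\<Lambda> \<inter> (K + C))"
      by (simp only: S_def)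
  qed
qed

text \<open>The points of \<open>\<Gamma>\<close> and of its complement are counted in the same
  window \<open>K n + C\<close>, so their lower bounds add. The translate x = 0 suffices: its count
  is at least the infimum for \<open>\<Gamma>\<close> and at most the supremum for
  \<open>\<Lambda>\<close>.\<close>

lemma (in formal_degree_rep) lower_density_add_degree_le_upper_density:
  fixes \<Lambda> \<Gamma> Q :: "'g set"
  assumes K: "strong_folner \<mu> K" and sep: "relatively_separated \<Lambda>" and sub: "\<Gamma> \<subseteq> \<Lambda>"
    and fr: "hilbert_frame (\<Lambda> - \<Gamma>) (\<lambda>l. \<pi> l g) A B" and g0: "g \<noteq> 0"
    and Q: "compact_symmetric_nbhd Q" and g: "g \<in> localized_vectors \<mu> Q \<pi>"
  shows "ennreal d + lower_beurling_density \<mu> K \<Gamma> \<le> upper_beurling_density \<mu> K \<Lambda>"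
proof -
  let ?L = "lower_beurling_density \<mu> K \<Gamma>" and ?U = "upper_beurling_density \<mu> K \<Lambda>"
  have lim_L: "(\<lambda>n. INF x. pts (\<Gamma> \<inter> (\<lambda>a. x + a) ` K n) / emeasure \<mu> (K n)) \<longlonglongrightarrow> ?L"
    by (rule tendsto_lower_beurling_density[OF K relatively_separated_subset[OF sep sub] Q])
  have lim_U: "(\<lambda>n. SUP x. pts (\<Lambda> \<inter> (\<lambda>a. x + a) ` K n) / emeasure \<mu> (K n)) \<longlonglongrightarrow> ?U"
    by (rule tendsto_upper_beurling_density[OF K sep])
  have step: "ennreal (d * (1 - e)) + ?L \<le> ?U" if e: "0 < e" for e
  proof -
    obtain C0 where C0: "compact C0" and low: "\<And>K. compact K \<Longrightarrow>
        ennreal (d * (1 - e)) * emeasure \<mu> K \<le> pts ((\<Lambda> - \<Gamma>) \<inter> (K + C0))"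
      using frame_pts_lower_bound[OF fr g0 Q g e] by metis
    \<comment> \<open>Adding 0 ensures that \<open>K n\<close> is contained in
      \<open>K n + C\<close>, so no point of \<open>\<Gamma>\<close> in \<open>K n\<close> is
      lost.\<close>
    define C where "C = insert 0 C0"
    have C: "compact C" using C0 by (simp add: C_def compact_insert)
    obtain \<delta> :: "nat \<Rightarrow> ennreal" where \<delta>: "\<delta> \<longlonglongrightarrow> 0"
      and bd: "\<And>n x. pts (\<Lambda> \<inter> (\<lambda>a. x + a) ` (K n + C)) / emeasure \<mu> (K n)
        \<le> pts (\<Lambda> \<inter> (\<lambda>a. x + a) ` K n) / emeasure \<mu> (K n) + \<delta> n"
      by (rule folner_boundary_density[OF K sep C Q]) blast
    have "ennreal (d * (1 - e)) + ?L \<le> ?U + 0"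
    proof (rule LIMSEQ_le)
      show "(\<lambda>n. ennreal (d * (1 - e)) + (INF x. pts (\<Gamma> \<inter> (\<lambda>a. x + a) ` K n) / emeasure \<mu> (K n)))
          \<longlonglongrightarrow> ennreal (d * (1 - e)) + ?L"
        by (intro tendsto_add tendsto_const lim_L)
      show "(\<lambda>n. (SUP x. pts (\<Lambda> \<inter> (\<lambda>a. x + a) ` K n) / emeasure \<mu> (K n)) + \<delta> n) \<longlonglongrightarrow> ?U + 0"
        by (intro tendsto_add lim_U \<delta>)
      show "\<exists>N. \<forall>n\<ge>N. ennreal (d * (1 - e)) + (INF x. pts (\<Gamma> \<inter> (\<lambda>a. x + a) ` K n) / emeasure \<mu> (K n))
          \<le> (SUP x. pts (\<Lambda> \<inter> (\<lambda>a. x + a) ` K n) / emeasure \<mu> (K n)) + \<delta> n"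
      proof (intro exI[of _ 0] allI impI)
        fix n
        let ?k = "emeasure \<mu> (K n)"
        have Kn: "compact (K n)" by (rule folner_compact[OF K])
        have "(INF x. pts (\<Gamma> \<inter> (\<lambda>a. x + a) ` K n) / ?k) \<le> pts (\<Gamma> \<inter> (\<lambda>a. 0 + a) ` K n) / ?k"
          by (rule INF_lower) simp
        also have "\<dots> \<le> pts (\<Gamma> \<inter> (K n + C)) / ?k"
        proof (intro divide_right_mono_ennreal pts_mono)
          have "a \<in> K n + C" if "a \<in> K n" for a
            using set_plus_intro[OF that, of 0 C] by (simp add: C_def)
          then show "\<Gamma> \<inter> (\<lambda>a. 0 + a) ` K n \<subseteq> \<Gamma> \<inter> (K n + C)" by auto
        qed
        finally have \<Gamma>_le: "(INF x. pts (\<Gamma> \<inter> (\<lambda>a. x + a) ` K n) / ?k) \<le> pts (\<Gamma> \<inter> (K n + C)) / ?k" .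
        have "ennreal (d * (1 - e)) * ?k \<le> pts ((\<Lambda> - \<Gamma>) \<inter> (K n + C0))" by (rule low[OF Kn])
        also have "\<dots> \<le> pts ((\<Lambda> - \<Gamma>) \<inter> (K n + C))"
          by (rule pts_mono) (auto simp: C_def set_plus_def)
        finally have "ennreal (d * (1 - e)) \<le> pts ((\<Lambda> - \<Gamma>) \<inter> (K n + C)) / ?k"
          by (rule ennreal_le_divideI[OF folner_pos[OF K] folner_finite[OF K]])
        then have "ennreal (d * (1 - e)) + (INF x. pts (\<Gamma> \<inter> (\<lambda>a. x + a) ` K n) / ?k)
            \<le> pts ((\<Lambda> - \<Gamma>) \<inter> (K n + C)) / ?k + pts (\<Gamma> \<inter> (K n + C)) / ?k"
          using \<Gamma>_le by (rule add_mono)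
        also have "\<dots> = pts (\<Lambda> \<inter> (\<lambda>a. 0 + a) ` (K n + C)) / ?k"
        proof -
          have "pts ((\<Lambda> - \<Gamma>) \<inter> (K n + C)) + pts (\<Gamma> \<inter> (K n + C))
              = pts (((\<Lambda> - \<Gamma>) \<inter> (K n + C)) \<union> (\<Gamma> \<inter> (K n + C)))"
            by (rule plus_emeasure) auto
          also have "((\<Lambda> - \<Gamma>) \<inter> (K n + C)) \<union> (\<Gamma> \<inter> (K n + C)) = \<Lambda> \<inter> (\<lambda>a. 0 + a) ` (K n + C)"
            using sub by auto
          finally show ?thesis by (simp only: add_divide_distrib_ennreal[symmetric])
        qed
        also have "\<dots> \<le> pts (\<Lambda> \<inter> (\<lambda>a. 0 + a) ` K n) / ?k + \<delta> n" by (rule bd)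
        also have "\<dots> \<le> (SUP x. pts (\<Lambda> \<inter> (\<lambda>a. x + a) ` K n) / ?k) + \<delta> n"
          by (intro add_right_mono SUP_upper UNIV_I)
        finally show "ennreal (d * (1 - e)) + (INF x. pts (\<Gamma> \<inter> (\<lambda>a. x + a) ` K n) / ?k)
            \<le> (SUP x. pts (\<Lambda> \<inter> (\<lambda>a. x + a) ` K n) / ?k) + \<delta> n" .
      qed
    qed
    then show ?thesis by simp
  qed
  show ?thesis
  proof (rule LIMSEQ_le_const2)
    \<comment> \<open>The tolerance e runs through 1/(n+1), and the closed inequality survives the
      limit.\<close>
    have "(\<lambda>n. ennreal (d * (1 - inverse (real (Suc n)))) + ?L) \<longlonglongrightarrow> ennreal (d * (1 - 0)) + ?L"
      by (intro tendsto_intros tendsto_ennrealI LIMSEQ_inverse_real_of_nat)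
    then show "(\<lambda>n. ennreal (d * (1 - inverse (real (Suc n)))) + ?L) \<longlonglongrightarrow> ennreal d + ?L" by simp
    show "\<exists>N. \<forall>n\<ge>N. ennreal (d * (1 - inverse (real (Suc n)))) + ?L \<le> ?U"
      by (intro exI[of _ 0] allI impI step) simp
  qed
qed

theorem proposition4p3:
  fixes \<mu> :: "'g::{topological_group_add, t2_space, second_countable_topology} measure"
    and \<pi> :: "'g \<Rightarrow> 'h \<Rightarrow> 'h::complex_hilbert_space"
    and Q :: "'g set"
    and d :: real
    and K :: "nat \<Rightarrow> 'g set"
    and \<Lambda> \<Gamma> :: "'g set"
    and g :: 'h
  assumes "locally compact (UNIV :: 'g set)"
    and "haar_measure \<mu>"
    and "unimodular \<mu>"
    and "amenable \<mu>"
    and "compact_symmetric_nbhd Q"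
    and "discrete_series \<mu> \<pi>"
    and "formal_degree \<mu> \<pi> d"
    and "strong_folner \<mu> K"
    and "discrete \<Lambda>"
    and "g \<in> localized_vectors \<mu> Q \<pi>"
    and "is_frame \<Lambda> (\<lambda>l. \<pi> l g)"
    and "\<Gamma> \<subseteq> \<Lambda>"
    and "lower_beurling_density \<mu> K \<Gamma> > 0"
    and "is_frame (\<Lambda> - \<Gamma>) (\<lambda>l. \<pi> l g)"
  shows "upper_beurling_density \<mu> K \<Lambda> > ennreal d"
proof -
  have Q: "compact_symmetric_nbhd Q" and K: "strong_folner \<mu> K" and sub: "\<Gamma> \<subseteq> \<Lambda>"
    and g: "g \<in> localized_vectors \<mu> Q \<pi>"
    by fact+
  interpret formal_degree_rep \<mu> \<pi> d
    using assms by unfold_locales (simp_all add: discrete_series_def)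
  obtain A B where fr: "hilbert_frame \<Lambda> (\<lambda>l. \<pi> l g) A B"
    by (rule is_frameE[OF \<open>is_frame \<Lambda> (\<lambda>l. \<pi> l g)\<close>])
  interpret fr: hilbert_frame \<Lambda> "\<lambda>l. \<pi> l g" A B by (rule fr)
  obtain A' B' where fr': "hilbert_frame (\<Lambda> - \<Gamma>) (\<lambda>l. \<pi> l g) A' B'"
    by (rule is_frameE[OF \<open>is_frame (\<Lambda> - \<Gamma>) (\<lambda>l. \<pi> l g)\<close>])
  \<comment> \<open>For g = 0 every frame coefficient vanishes, contradicting the lower frame bound
    at a nonzero vector; square integrability supplies such a vector.\<close>
  have g0: "g \<noteq> 0"
  proof
    assume "g = 0"
    obtain h :: 'h where h: "h \<noteq> 0"
      using \<open>discrete_series \<mu> \<pi>\<close> by (auto simp: discrete_series_def square_integrable_rep_def)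
    have "norm (\<pi> l g) = 0" for l unfolding norm_rep using \<open>g = 0\<close> by simp
    then have "\<pi> l g = 0" for l by (simp only: norm_eq_zero)
    then have "A * (norm h)\<^sup>2 \<le> 0" using fr.lower_bound[of h] by simp
    then show False using fr.lower_pos h by (simp add: mult_le_0_iff)
  qed
  \<comment> \<open>Strictness uses that \<open>ennreal d\<close> is finite: adding a positive
    amount to infinity would gain nothing.\<close>
  have "ennreal d < ennreal d + lower_beurling_density \<mu> K \<Gamma>"
    using ennreal_add_left_cancel_less[of "ennreal d" 0 "lower_beurling_density \<mu> K \<Gamma>"]
      \<open>lower_beurling_density \<mu> K \<Gamma> > 0\<close> by simp
  also have "\<dots> \<le> upper_beurling_density \<mu> K \<Lambda>"
    by (rule lower_density_add_degree_le_upper_density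
        [OF K relatively_separated_if_frame[OF fr g0] sub fr' g0 Q g])
  finally show ?thesis .
qed

end
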